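(* Let $F$ be a probability distribution on the nonnegative integers with mean $\lambda$ and finite variance $V$, such that the GCD of the support of $F$ is $1$. Consider the measure $\mathbf{P}_{F,m}$, under which $\{A_j,B_j:1\le j\le m\}$ are IID with common distribution $F$ (and so have common variance $V$). Then as $m\to\infty$, $$\mathbf{E}\,\beta = (1+o(1))\,\frac{2}{3}\sqrt{\frac{V}{\pi}}\; m^{3/2}.$$
   Context: For $m\ge 1$, let $\mathcal{S}$ be the set of sequences $\omega=(A_1,\dots,A_m,B_1,\dots,B_m)$ of nonnegative integers; $\mathbf{P}_{F,m}$ is the probability measure on $\mathcal{S}$ making the $2m$ coordinates IID with distribution $F$. To $\omega\in\mathcal{S}$ associate the polynomials $f(k)=\prod_{j=1}^m (k-j)^{A_j}$ and $g(k)=\prod_{j=1}^m (k-j)^{B_j}$. Define $\beta(\omega)$ to be the minimal degree of a polynomial $c$ for which there exist polynomials $a,b$ with $$\frac{f(k)}{g(k)} = \frac{a(k)}{b(k)}\,\frac{c(k+1)}{c(k)}$$ and $\gcd(a(x),b(x+h))=1$ for all nonnegative integers $h$. *)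

theory Defs
  imports
    "HOL-Probability.Probability"
    "HOL-Computational_Algebra.Computational_Algebra"
    "HOL-Library.Landau_Symbols"
begin

definition root_prod :: "nat \<Rightarrow> (nat \<Rightarrow> nat) \<Rightarrow> complex poly" where
  "root_prod m A = (\<Prod>j=1..m. [:- of_nat j, 1:] ^ A j)"

abbreviation shift_poly :: "nat \<Rightarrow> complex poly \<Rightarrow> complex poly" where
  "shift_poly h p \<equiv> pcompose p [:of_nat h, 1:]"

(* The nonzero conditions are explicit because Fract p 0 = 0; a is nonzero as soon as f is. *)
definition gosper_form ::
  "complex poly \<Rightarrow> complex poly \<Rightarrow> complex poly \<Rightarrow> complex poly \<Rightarrow> complex poly \<Rightarrow> bool" where
  "gosper_form f g a b c \<longleftrightarrow>
     b \<noteq> 0 \<and> c \<noteq> 0 \<and>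
     Fract f g = Fract a b * Fract (shift_poly 1 c) c \<and>
     (\<forall>h::nat. coprime a (shift_poly h b))"

definition gosper_beta :: "nat \<Rightarrow> (nat \<Rightarrow> nat) \<times> (nat \<Rightarrow> nat) \<Rightarrow> nat" where
  "gosper_beta m = (\<lambda>(A, B).
     LEAST d. \<exists>a b c. gosper_form (root_prod m A) (root_prod m B) a b c \<and> degree c = d)"

(* A sequence (A_1, ..., A_m) is a function supported on {1..m}: Pi_pmf makes its values there
   independent with law F and sets the remaining values to 0. *)
definition gosper_pmf :: "nat pmf \<Rightarrow> nat \<Rightarrow> ((nat \<Rightarrow> nat) \<times> (nat \<Rightarrow> nat)) pmf" where
  "gosper_pmf F m = pair_pmf (Pi_pmf {1..m} 0 (\<lambda>_. F)) (Pi_pmf {1..m} 0 (\<lambda>_. F))"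

end

theory Submission imports Defs "HOL-Real_Asymp.Real_Asymp" begin

text \<open>Let \<open>S\<close> be the walk with steps \<open>A\<^sub>i - B\<^sub>i\<close>. Comparing root multiplicities, a Gosper form amounts
  to a function \<open>T \<le> S\<close> that first decreases and then increases, the multiplicity of \<open>r + 1\<close> in \<open>c\<close>
  being \<open>S\<^sub>r - T\<^sub>r\<close>. The largest such \<open>T\<close> is the maximum of the running minimum \<open>P\<^sub>r = min\<^bsub>s\<le>r\<^esub> S\<^sub>s\<close> and the
  tail minimum \<open>Q\<^sub>r = min\<^bsub>t\<ge>r\<^esub> S\<^sub>t\<close>, hence \<open>\<beta> = \<Sum>\<^sub>r (S\<^sub>r - max P\<^sub>r Q\<^sub>r)\<close>.

  Since \<open>max P\<^sub>r Q\<^sub>r = P\<^sub>r + Q\<^sub>r - min S\<close>, the expectation is exactly \<open>\<Sum>\<^sub>r (e\<^sub>r + e\<^bsub>m-r\<^esub> - e\<^sub>m)\<close> with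
  \<open>e\<^sub>n = - E min\<^bsub>s\<le>n\<^esub> S\<^sub>s\<close>. Spitzer's identity gives \<open>e\<^sub>n - e\<^bsub>n-1\<^esub> = E \<bar>S\<^sub>n\<bar> / (2 n)\<close>, the central limit theorem
  with bounded second moments gives \<open>E \<bar>S\<^sub>n\<bar> \<sim> 2 sqrt (V n / \<pi>)\<close>, and two applications of the
  Stolz--Cesaro theorem finish the proof.\<close>

section \<open>Gosper forms and the minima of a walk\<close>

definition walk :: "(nat \<Rightarrow> int) \<Rightarrow> nat \<Rightarrow> int" where
  "walk x n = (\<Sum>i=1..n. x i)"

definition run_min :: "(nat \<Rightarrow> int) \<Rightarrow> nat \<Rightarrow> int" where
  "run_min x n = Min (walk x ` {..n})"

definition tail_min :: "nat \<Rightarrow> (nat \<Rightarrow> int) \<Rightarrow> nat \<Rightarrow> int" where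
  "tail_min m x r = Min (walk x ` {r..m})"

definition valley :: "nat \<Rightarrow> (nat \<Rightarrow> int) \<Rightarrow> nat \<Rightarrow> int" where
  "valley m x r = max (run_min x r) (tail_min m x r)"

lemma walk_0 [simp]: "walk x 0 = 0"
  by (simp add: walk_def)

lemma walk_Suc: "walk x (Suc n) = walk x n + x (Suc n)"
  by (simp add: walk_def)

lemma walk_cong: "(\<And>i. 1 \<le> i \<Longrightarrow> i \<le> n \<Longrightarrow> x i = y i) \<Longrightarrow> walk x n = walk y n"
  by (simp add: walk_def)

lemma walk_shift: "walk (\<lambda>i. x (i + r)) n = walk x (r + n) - walk x r"
  by (induction n) (simp_all add: walk_Suc add.commute)

lemma run_min_cong: "(\<And>i. 1 \<le> i \<Longrightarrow> i \<le> n \<Longrightarrow> x i = y i) \<Longrightarrow> run_min x n = run_min y n"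
  unfolding run_min_def by (intro arg_cong[of _ _ Min] image_cong refl walk_cong) auto

lemma run_min_le: "s \<le> r \<Longrightarrow> run_min x r \<le> walk x s"
  by (simp add: run_min_def)

lemma run_min_greatest: "(\<And>s. s \<le> r \<Longrightarrow> z \<le> walk x s) \<Longrightarrow> z \<le> run_min x r"
  by (simp add: run_min_def)

lemma run_min_antimono: "r \<le> s \<Longrightarrow> run_min x s \<le> run_min x r"
  by (rule run_min_greatest) (simp add: run_min_le)

lemma run_min_0 [simp]: "run_min x 0 = 0"
  by (simp add: run_min_def)

lemma run_min_Suc: "run_min x (Suc n) = min (run_min x n) (walk x (Suc n))"
  by (simp add: run_min_def atMost_Suc min.commute)

lemma tail_min_le: "r \<le> t \<Longrightarrow> t \<le> m \<Longrightarrow> tail_min m x r \<le> walk x t"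
  by (simp add: tail_min_def)

lemma tail_min_greatest:
  "r \<le> m \<Longrightarrow> (\<And>t. r \<le> t \<Longrightarrow> t \<le> m \<Longrightarrow> z \<le> walk x t) \<Longrightarrow> z \<le> tail_min m x r"
  by (simp add: tail_min_def)

lemma tail_min_mono: "r \<le> s \<Longrightarrow> s \<le> m \<Longrightarrow> tail_min m x r \<le> tail_min m x s"
  by (rule tail_min_greatest) (simp_all add: tail_min_le)

text \<open>Restarting the walk at time \<open>r\<close> turns the future into a running minimum
  over \<open>m - r\<close> steps. This form lets the law of the future be recognised later as that
  of a shorter walk.\<close>

lemma tail_min_conv_run_min:
  assumes "r \<le> m"
  shows "tail_min m x r = walk x r + run_min (\<lambda>i. x (i + r)) (m - r)"
proof (rule antisym)
  have "tail_min m x r - walk x r \<le> run_min (\<lambda>i. x (i + r)) (m - r)"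
    using assms by (intro run_min_greatest) (auto simp: walk_shift intro!: tail_min_le)
  then show "tail_min m x r \<le> walk x r + run_min (\<lambda>i. x (i + r)) (m - r)" by simp
  show "walk x r + run_min (\<lambda>i. x (i + r)) (m - r) \<le> tail_min m x r"
  proof (rule tail_min_greatest[OF assms])
    fix t assume "r \<le> t" "t \<le> m"
    then show "walk x r + run_min (\<lambda>i. x (i + r)) (m - r) \<le> walk x t"
      using run_min_le[of "t - r" "m - r" "\<lambda>i. x (i + r)"] by (simp add: walk_shift diff_le_mono)
  qed
qed

lemma run_min_split:
  assumes "r \<le> m"
  shows "run_min x m = min (run_min x r) (tail_min m x r)"
proof -
  have "{..m} = {..r} \<union> {r..m}" using assms by auto
  then show ?thesis
    using assms by (simp add: run_min_def tail_min_def image_Un Min_Un)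
qed

lemma valley_le_walk: "r \<le> m \<Longrightarrow> valley m x r \<le> walk x r"
  by (simp add: valley_def run_min_le tail_min_le)

lemma valley_0 [simp]: "valley m x 0 = 0"
  using tail_min_le[of 0 0 m x] by (simp add: valley_def)

lemma valley_last [simp]: "valley m x m = walk x m"
  using run_min_le[of m m x] by (simp add: valley_def tail_min_def)

text \<open>Since \<open>run_min\<close> never rises, the valley can only rise through
  \<open>tail_min\<close>. Once \<open>tail_min\<close> exceeds \<open>run_min\<close> it stays
  above it and does not decrease, so no descent follows an ascent. This unimodality becomes the
  coprimality of \<open>a\<close> and the shifts of \<open>b\<close>.\<close>

lemma valley_mono_after_ascent:
  assumes "valley m x i < valley m x (Suc i)" "i \<le> j" "j < m"
  shows "valley m x j \<le> valley m x (Suc j)"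
proof (cases "i = j")
  case False
  have *: "run_min x (Suc i) < tail_min m x (Suc i)"
    using assms run_min_antimono[of i "Suc i" x] by (auto simp: valley_def)
  have "run_min x j \<le> run_min x (Suc i)"
    using assms False by (intro run_min_antimono) auto
  moreover have "tail_min m x (Suc i) \<le> tail_min m x j" "tail_min m x j \<le> tail_min m x (Suc j)"
    using assms False by (auto intro!: tail_min_mono)
  ultimately show ?thesis
    using * by (simp add: valley_def)
qed (use assms in simp)

section \<open>Root multiplicities and products of linear factors\<close>

lemma order_pcompose_linear:
  fixes p :: "'a::field_char_0 poly"
  assumes "p \<noteq> 0"
  shows "order x (pcompose p [:h, 1:]) = order (x + h) p"
proof -
  obtain q where p: "p = [:- (x + h), 1:] ^ order (x + h) p * q"
    and q: "\<not> [:- (x + h), 1:] dvd q"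
    using order_decomp[OF assms] by blast
  have hom: "pcompose (u ^ n) [:h, 1:] = pcompose u [:h, 1:] ^ n" for u :: "'a poly" and n
    by (induction n) (simp_all add: pcompose_mult pcompose_1)
  have "pcompose p [:h, 1:] = [:- x, 1:] ^ order (x + h) p * pcompose q [:h, 1:]"
    by (subst p) (simp add: pcompose_mult hom pcompose_pCons)
  moreover have "poly (pcompose q [:h, 1:]) x \<noteq> 0"
    using q by (simp add: poly_pcompose poly_eq_0_iff_dvd add.commute)
  ultimately show ?thesis
    by (metis order_0I order_mult order_power_n_n add.right_neutral mult_eq_0_iff
        poly_0 power_not_zero pCons_eq_0_iff zero_neq_one)
qed

lemma root_prod_nonzero [simp]: "root_prod m A \<noteq> 0"
  by (simp add: root_prod_def)

lemma root_prod_mult: "root_prod m A * root_prod m B = root_prod m (\<lambda>j. A j + B j)"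
  by (simp add: root_prod_def power_add prod.distrib)

lemma root_prod_cong: "(\<And>j. 1 \<le> j \<Longrightarrow> j \<le> m \<Longrightarrow> A j = B j) \<Longrightarrow> root_prod m A = root_prod m B"
  by (simp add: root_prod_def)

lemma root_prod_Suc: "root_prod (Suc m) A = root_prod m A * [:- of_nat (Suc m), 1:] ^ A (Suc m)"
  by (simp add: root_prod_def)

lemma degree_root_prod: "degree (root_prod m A) = (\<Sum>j=1..m. A j)"
  unfolding root_prod_def
  by (subst degree_prod_sum_eq) (auto simp: degree_linear_power)

lemma order_root_prod:
  "order (of_nat i) (root_prod m A) = (if 1 \<le> i \<and> i \<le> m then A i else 0)"
proof (induction m)
  case 0
  show ?case by (simp add: root_prod_def)
next
  case (Suc m)
  have "order (of_nat i) ([:- of_nat (Suc m) :: complex, 1:] ^ n) = (if i = Suc m then n else 0)"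
    for n and i :: nat
  proof (cases "i = Suc m")
    case True
    then show ?thesis by (simp only: order_power_n_n refl if_True)
  next
    case False
    then have "of_nat i \<noteq> (of_nat (Suc m) :: complex)" by (simp del: of_nat_Suc)
    moreover have "poly ([:- of_nat (Suc m) :: complex, 1:] ^ n) (of_nat i)
        = (of_nat i - of_nat (Suc m)) ^ n"
      by (simp add: poly_power algebra_simps)
    ultimately have "poly ([:- of_nat (Suc m) :: complex, 1:] ^ n) (of_nat i) \<noteq> 0"
      by (simp del: of_nat_Suc)
    then have "order (of_nat i) ([:- of_nat (Suc m) :: complex, 1:] ^ n) = 0"
      by (rule order_0I)
    then show ?thesis using False by (simp only: if_False)
  qed
  then have "order (of_nat i) (root_prod (Suc m) A)
      = order (of_nat i) (root_prod m A) + (if i = Suc m then A (Suc m) else 0)"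
    by (subst root_prod_Suc, subst order_mult) (simp_all del: of_nat_Suc)
  then show ?case using Suc.IH by auto
qed

lemma poly_root_prod_eq_0_iff:
  "poly (root_prod m A) z = 0 \<longleftrightarrow> (\<exists>j. 1 \<le> j \<and> j \<le> m \<and> A j \<noteq> 0 \<and> z = of_nat j)"
  by (auto simp: root_prod_def poly_prod poly_power)

text \<open>The substitution moves the root \<open>j\<close> to \<open>j - 1\<close>, so the range
  of roots becomes \<open>0..m-1\<close>. The two hypotheses make the factors at \<open>0\<close>
  and \<open>m\<close>, where this range differs from \<open>1..m\<close>, trivial.\<close>

lemma shift_root_prod:
  assumes "A 0 = 0" "A m = 0"
  shows "shift_poly 1 (root_prod m (\<lambda>j. A (j - 1))) = root_prod m A"
proof -
  have hom: "pcompose (u ^ n) v = pcompose u v ^ n" for u v :: "complex poly" and n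
    by (induction n) (simp_all add: pcompose_mult pcompose_1)
  have "shift_poly 1 (root_prod m (\<lambda>j. A (j - 1)))
      = (\<Prod>j=1..m. [:- of_nat (j - 1), 1:] ^ A (j - 1))"
    unfolding root_prod_def pcompose_prod hom
    by (intro prod.cong refl) (auto simp: pcompose_pCons of_nat_diff)
  also have "\<dots> = (\<Prod>j=0..<m. [:- of_nat j, 1:] ^ A j)"
    by (rule prod.reindex_bij_witness[of _ Suc "\<lambda>j. j - 1"]) auto
  also have "\<dots> = root_prod m A"
    unfolding root_prod_def
    by (rule prod.mono_neutral_cong) (use assms in \<open>auto simp: not_less not_le le_Suc_eq Suc_le_eq\<close>)
  finally show ?thesis .
qed

text \<open>A common divisor that is not a unit has a complex root by the fundamental theorem of
  algebra, and that root is shared by both polynomials.\<close>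

lemma coprime_complex_polyI:
  fixes p q :: "complex poly"
  assumes "p \<noteq> 0" "\<And>z. poly p z = 0 \<Longrightarrow> poly q z \<noteq> 0"
  shows "coprime p q"
proof (rule coprimeI)
  fix d assume d: "d dvd p" "d dvd q"
  show "is_unit d"
  proof (rule ccontr)
    assume "\<not> is_unit d"
    moreover have "d \<noteq> 0" using d assms(1) by auto
    ultimately have "\<not> constant (poly d)"
      by (simp add: constant_degree is_unit_iff_degree)
    then obtain z where "poly d z = 0"
      using fundamental_theorem_of_algebra by blast
    then show False using assms(2)[of z] d by (auto elim!: dvdE)
  qed
qed

lemma coprime_poly_no_common_root:
  fixes p q :: "'a::field poly"
  assumes "coprime p q" "poly p z = 0"
  shows "poly q z \<noteq> 0"
proof
  assume "poly q z = 0"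
  then have "is_unit [:- z, 1:]"
    using assms by (intro coprime_common_divisor[OF assms(1)]) (simp_all add: poly_eq_0_iff_dvd)
  then show False by (simp add: is_unit_iff_degree)
qed

section \<open>The minimal degree of \<open>c\<close> in a Gosper form\<close>

lemma gosper_form_root_prod_iff:
  "gosper_form (root_prod m A) (root_prod m B) a b c \<longleftrightarrow>
     b \<noteq> 0 \<and> c \<noteq> 0 \<and>
     root_prod m A * (b * c) = a * shift_poly 1 c * root_prod m B \<and>
     (\<forall>h::nat. coprime a (shift_poly h b))"
  by (auto simp: gosper_form_def eq_fract)

text \<open>Let \<open>T\<close> be the walk minus the multiplicity of \<open>r + 1\<close> in
  \<open>c\<close>. Then \<open>T\<close> steps up at the roots of \<open>a\<close> and down at the
  roots of \<open>b\<close>. Coprimality with all shifts forbids a root of \<open>b\<close> at or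
  after a root of \<open>a\<close>, so \<open>T r\<close> is at most all earlier values of
  \<open>T\<close> or at most all later ones. As \<open>T\<close> lies below the walk, this bounds
  \<open>T r\<close> by \<open>run_min\<close> or by \<open>tail_min\<close>.\<close>

lemma order_ge_of_gosper_form:
  fixes A B :: "nat \<Rightarrow> nat"
  defines "x \<equiv> \<lambda>i. int (A i) - int (B i)"
  assumes form: "gosper_form (root_prod m A) (root_prod m B) a b c" and r: "r \<le> m"
  shows "walk x r - valley m x r \<le> int (order (of_nat (Suc r)) c)"
proof -
  define f g where "f = root_prod m A" and "g = root_prod m B"
  have nz: "b \<noteq> 0" "c \<noteq> 0" "f \<noteq> 0" "g \<noteq> 0"
    and eq: "f * (b * c) = a * shift_poly 1 c * g"
    and cop: "\<And>h::nat. coprime a (shift_poly h b)"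
    using form unfolding gosper_form_root_prod_iff f_def g_def by auto
  have nz': "a \<noteq> 0" "shift_poly 1 c \<noteq> 0"
    using eq nz by auto
  define o' where "o' p i = int (order (of_nat i) p)" for i :: nat and p :: "complex poly"
  \<comment> \<open>Multiplicities of the root \<open>i\<close> on both sides; the shifted
    \<open>c\<close> contributes the multiplicity of \<open>c\<close> at
    \<open>i + 1\<close>.\<close>
  have order_eq: "int (A i) + o' b i + o' c i = int (B i) + o' a i + o' c (Suc i)"
    if "1 \<le> i" "i \<le> m" for i
  proof -
    have "order (of_nat i) (f * (b * c)) = order (of_nat i) (a * shift_poly 1 c * g)"
      by (simp only: eq)
    then have "order (of_nat i) f + (order (of_nat i) b + order (of_nat i) c)
        = order (of_nat i) a + order (of_nat i) (shift_poly 1 c) + order (of_nat i) g"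
      using nz nz' by (simp add: order_mult)
    then show ?thesis
      using that nz order_pcompose_linear[of c "of_nat i" "of_nat 1"]
      by (simp add: f_def g_def order_root_prod o'_def add_ac)
  qed
  define T where "T r = walk x r - o' c (Suc r)" for r
  have Tstep: "T (Suc i) = T i + o' a (Suc i) - o' b (Suc i)" if "i < m" for i
    using order_eq[of "Suc i"] that by (simp add: T_def walk_Suc x_def)
  have T_le: "T i \<le> walk x i" for i
    by (simp add: T_def o'_def)
  have "T r \<le> valley m x r"
  \<comment> \<open>Without a root of \<open>a\<close> in \<open>1..r\<close>, \<open>T\<close>
    never rises before time \<open>r\<close>; with one, it never falls after time
    \<open>r\<close>.\<close>
  proof (cases "\<exists>i. 1 \<le> i \<and> i \<le> r \<and> o' a i \<noteq> 0")
    case False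
    have "T r \<le> T s" if "s \<le> r" for s
      using that
    proof (induction rule: inc_induct)
      case (step n)
      have "o' a (Suc n) = 0" using step.hyps False by auto
      then have "T (Suc n) \<le> T n" using Tstep[of n] step.hyps r by (simp add: o'_def)
      then show ?case using step.IH by simp
    qed simp
    then have "T r \<le> run_min x r"
      using T_le order.trans by (intro run_min_greatest) blast
    then show ?thesis by (simp add: valley_def)
  next
    case True
    then obtain i where i: "1 \<le> i" "i \<le> r" "o' a i \<noteq> 0" by blast
    have b0: "o' b j = 0" if "i \<le> j" for j
    proof -
      have "poly a (of_nat i) = 0"
        using i nz' by (simp add: o'_def order_root)
      \<comment> \<open>The shift \<open>h = j - i\<close> would carry a root \<open>j\<close> of
        \<open>b\<close> onto the root \<open>i\<close> of \<open>a\<close>.\<close>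
      then have "poly (shift_poly (j - i) b) (of_nat i) \<noteq> 0"
        using cop coprime_poly_no_common_root by blast
      then have "poly b (of_nat j) \<noteq> 0"
        using that by (simp add: poly_pcompose of_nat_diff)
      then show ?thesis by (simp add: o'_def order_0I)
    qed
    have "T r \<le> T t" if "r \<le> t" "t \<le> m" for t
      using that
    proof (induction rule: dec_induct)
      case (step n)
      have "o' b (Suc n) = 0" using step.hyps i b0 by simp
      then have "T n \<le> T (Suc n)" using Tstep[of n] step.prems by (simp add: o'_def)
      then show ?case using step by simp
    qed simp
    then have "T r \<le> tail_min m x r"
      using T_le order.trans r by (intro tail_min_greatest) blast+
    then show ?thesis by (simp add: valley_def)
  qed
  then show ?thesis by (simp add: T_def o'_def)
qed

lemma sum_order_le_degree_on:
  fixes p :: "'a::idom poly"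
  assumes "p \<noteq> 0" "finite S"
  shows "(\<Sum>x\<in>S. order x p) \<le> degree p"
proof -
  have "(\<Sum>x\<in>S. order x p) = (\<Sum>x\<in>{x\<in>S. poly p x = 0}. order x p)"
    using assms by (intro sum.mono_neutral_right) (auto simp: order_0I)
  also have "\<dots> \<le> (\<Sum>x | poly p x = 0. order x p)"
    using assms by (intro sum_mono2) (auto simp: poly_roots_finite)
  also have "\<dots> \<le> degree p"
    using assms(1) by (rule sum_order_le_degree)
  finally show ?thesis .
qed

lemma degree_ge_of_gosper_form:
  fixes A B :: "nat \<Rightarrow> nat"
  defines "x \<equiv> \<lambda>i. int (A i) - int (B i)"
  assumes form: "gosper_form (root_prod m A) (root_prod m B) a b c"
  shows "(\<Sum>r\<le>m. walk x r - valley m x r) \<le> int (degree c)"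
proof -
  have c: "c \<noteq> 0" using form by (simp add: gosper_form_def)
  have "(\<Sum>r\<le>m. walk x r - valley m x r) \<le> (\<Sum>r\<le>m. int (order (of_nat (Suc r)) c))"
    using order_ge_of_gosper_form[OF form] by (intro sum_mono) (simp add: x_def)
  also have "\<dots> = int (\<Sum>r\<le>m. order (of_nat (Suc r)) c)"
    by simp
  also have "(\<Sum>r\<le>m. order (of_nat (Suc r)) c) = (\<Sum>z\<in>(\<lambda>r. of_nat (Suc r)) ` {..m}. order z c)"
    by (subst sum.reindex) (auto intro!: inj_onI simp del: of_nat_Suc)
  also have "int \<dots> \<le> int (degree c)"
    by (simp only: of_nat_le_iff, rule sum_order_le_degree_on[OF c]) simp
  finally show ?thesis .
qed

text \<open>Equality is reached by letting the valley play the role of \<open>T\<close>: its ascents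
  give the roots of \<open>a\<close>, its descents those of \<open>b\<close>, and its distance to
  the walk at time \<open>r\<close> the multiplicity of \<open>r + 1\<close> in
  \<open>c\<close>.\<close>

lemma gosper_form_exists:
  fixes A B :: "nat \<Rightarrow> nat"
  defines "x \<equiv> \<lambda>i. int (A i) - int (B i)"
  shows "\<exists>a b c. gosper_form (root_prod m A) (root_prod m B) a b c \<and>
           int (degree c) = (\<Sum>r\<le>m. walk x r - valley m x r)"
proof -
  let ?T = "valley m x"
  \<comment> \<open>Truncation by \<open>nat\<close> makes \<open>\<alpha>\<close> and
    \<open>\<beta>\<close> the positive and negative parts of the increment of the valley.\<close>
  define \<alpha> where "\<alpha> i = nat (?T i - ?T (i - 1))" for i
  define \<beta> where "\<beta> i = nat (?T (i - 1) - ?T i)" for i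
  define \<gamma> where "\<gamma> i = nat (walk x i - ?T i)" for i
  have \<gamma>: "int (\<gamma> i) = walk x i - ?T i" if "i \<le> m" for i
    using valley_le_walk[OF that] by (simp add: \<gamma>_def)
  \<comment> \<open>The valley meets the walk at both ends, which is the boundary condition required
    by \<open>shift_root_prod\<close>.\<close>
  have \<gamma>0: "\<gamma> 0 = 0" "\<gamma> m = 0" by (simp_all add: \<gamma>_def)
  define a b c where "a = root_prod m \<alpha>" and "b = root_prod m \<beta>"
    and "c = root_prod m (\<lambda>j. \<gamma> (j - 1))"
  have c_shift: "shift_poly 1 c = root_prod m \<gamma>"
    unfolding c_def by (rule shift_root_prod[OF \<gamma>0])
  \<comment> \<open>Balance of multiplicities at the root \<open>i\<close>: the increment of the
    walk is that of the valley plus that of the gap \<open>\<gamma>\<close>.\<close>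
  have "A i + (\<beta> i + \<gamma> (i - 1)) = \<alpha> i + \<gamma> i + B i" if i: "1 \<le> i" "i \<le> m" for i
  proof -
    obtain k where k: "i = Suc k" using i by (cases i) auto
    have "int (\<alpha> i) - int (\<beta> i) = ?T i - ?T k"
      by (simp add: \<alpha>_def \<beta>_def k)
    moreover have "walk x i = walk x k + int (A i) - int (B i)"
      by (simp add: k walk_Suc) (simp add: x_def)
    ultimately have "int (A i) + (int (\<beta> i) + int (\<gamma> k)) = int (\<alpha> i) + int (\<gamma> i) + int (B i)"
      using \<gamma>[of i] \<gamma>[of k] i k by simp
    then show ?thesis by (simp add: k)
  qed
  then have "root_prod m A * (b * c) = a * shift_poly 1 c * root_prod m B"
    unfolding c_shift unfolding a_def b_def c_def root_prod_mult by (intro root_prod_cong) auto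
  moreover have "coprime a (shift_poly h b)" for h :: nat
  proof (rule coprime_complex_polyI)
    fix z assume "poly a z = 0"
    then obtain i where i: "1 \<le> i" "i \<le> m" "\<alpha> i \<noteq> 0" "z = of_nat i"
      by (auto simp: a_def poly_root_prod_eq_0_iff)
    show "poly (shift_poly h b) z \<noteq> 0"
    proof
      assume "poly (shift_poly h b) z = 0"
      then have "poly b (of_nat (i + h)) = 0"
        by (simp add: poly_pcompose i add.commute)
      then obtain j where j: "1 \<le> j" "j \<le> m" "\<beta> j \<noteq> 0" "complex_of_nat (i + h) = of_nat j"
        unfolding b_def poly_root_prod_eq_0_iff by blast
      then have "i + h = j" by (simp only: of_nat_eq_iff)
      \<comment> \<open>A root \<open>i\<close> of \<open>a\<close> and a root
        \<open>j = i + h\<close> of \<open>b\<close> would be an ascent of the valley with a descent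
        at the same or a later step.\<close>
      then have "i - 1 \<le> j - 1" "j - 1 < m" using j by linarith+
      moreover have "?T (i - 1) < ?T (Suc (i - 1))" "?T (Suc (j - 1)) < ?T (j - 1)"
        using i j by (simp_all add: \<alpha>_def \<beta>_def)
      ultimately show False
        using valley_mono_after_ascent[of m x "i - 1" "j - 1"] by simp
    qed
  qed (simp add: a_def)
  ultimately have "gosper_form (root_prod m A) (root_prod m B) a b c"
    by (simp add: gosper_form_root_prod_iff a_def b_def c_def)
  moreover have "int (degree c) = (\<Sum>r\<le>m. walk x r - ?T r)"
  proof -
    have "degree c = (\<Sum>r<m. \<gamma> r)"
      unfolding c_def degree_root_prod
      by (rule sum.reindex_bij_witness[of _ Suc "\<lambda>j. j - 1"]) auto
    also have "\<dots> = (\<Sum>r\<le>m. \<gamma> r)"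
      using \<gamma>0 by (simp flip: lessThan_Suc_atMost)
    finally show ?thesis using \<gamma> by simp
  qed
  ultimately show ?thesis by blast
qed

lemma gosper_beta_eq_sum:
  fixes A B :: "nat \<Rightarrow> nat"
  defines "x \<equiv> \<lambda>i. int (A i) - int (B i)"
  shows "int (gosper_beta m (A, B)) = (\<Sum>r\<le>m. walk x r - valley m x r)"
proof -
  obtain a b c where abc: "gosper_form (root_prod m A) (root_prod m B) a b c"
    "int (degree c) = (\<Sum>r\<le>m. walk x r - valley m x r)"
    using gosper_form_exists unfolding x_def by blast
  have "gosper_beta m (A, B) = degree c"
    unfolding gosper_beta_def prod.case
  proof (rule Least_equality)
    fix d assume "\<exists>a b c. gosper_form (root_prod m A) (root_prod m B) a b c \<and> degree c = d"
    then obtain a' b' c' where *: "gosper_form (root_prod m A) (root_prod m B) a' b' c'"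
      "degree c' = d" by blast
    then show "degree c \<le> d"
      using degree_ge_of_gosper_form[OF *(1)] abc(2) unfolding x_def by simp
  qed (use abc in blast)
  then show ?thesis using abc by simp
qed

text \<open>By \<open>max u v = u + v - min u v\<close>, where the smaller of the two minima is the
  global one. The right-hand side is linear in running minima, so expectations can be taken term by
  term.\<close>

lemma valley_conv_run_min:
  assumes "r \<le> m"
  shows "walk x r - valley m x r =
           run_min x m - run_min x r - run_min (\<lambda>i. x (i + r)) (m - r)"
  using run_min_split[OF assms, of x] tail_min_conv_run_min[OF assms, of x]
  by (simp add: valley_def)

section \<open>Spitzer's identity for the expected minimum\<close>

definition iid_pmf :: "int pmf \<Rightarrow> nat \<Rightarrow> (nat \<Rightarrow> int) pmf" where
  "iid_pmf p n = Pi_pmf {1..n} 0 (\<lambda>_. p)"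

text \<open>Any block of \<open>n\<close> consecutive steps is again an i.i.d. vector. The cut-off
  to \<open>0\<close> outside \<open>{1..n}\<close> restores the default value of
  \<open>Pi_pmf\<close>; the case \<open>r = 0\<close> is the marginal law of the first
  steps.\<close>

lemma map_iid_pmf_shift:
  assumes "r + n \<le> m"
  shows "map_pmf (\<lambda>x i. if i \<in> {1..n} then x (i + r) else 0) (iid_pmf p m) = iid_pmf p n"
proof -
  have "iid_pmf p n = map_pmf (\<lambda>x. x \<circ> (\<lambda>i. i + r)) (Pi_pmf {r+1..r+n} 0 (\<lambda>_. p))"
    unfolding iid_pmf_def
    by (rule Pi_pmf_bij_betw) (auto intro!: bij_betwI[where g = "\<lambda>i. i - r"])
  also have "Pi_pmf {r+1..r+n} 0 (\<lambda>_. p)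
      = map_pmf (\<lambda>x i. if i \<in> {r+1..r+n} then x i else 0) (iid_pmf p m)"
    unfolding iid_pmf_def using assms by (intro Pi_pmf_subset) auto
  finally show ?thesis
    by (auto simp: pmf.map_comp o_def intro!: arg_cong2[of _ _ _ _ map_pmf] ext)
qed

text \<open>Exchangeability of the steps, used below once with transpositions and once with a cyclic
  rotation.\<close>

lemma map_iid_pmf_permute:
  assumes "\<pi> permutes {1..n}"
  shows "map_pmf (\<lambda>x. x \<circ> \<pi>) (iid_pmf p n) = iid_pmf p n"
  unfolding iid_pmf_def
  by (rule Pi_pmf_bij_betw[symmetric])
    (use assms in \<open>auto simp: permutes_imp_bij permutes_not_in\<close>)

lemma walk_permute:
  assumes "\<pi> permutes {1..n}"
  shows "walk (x \<circ> \<pi>) n = walk x n"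
  unfolding walk_def using sum.permute[OF assms, of x] by (simp add: o_def)

text \<open>The sum of the absolute steps is the common dominating function for all integrability
  claims about walks and minima.\<close>

lemma abs_walk_le: "s \<le> n \<Longrightarrow> \<bar>walk x s\<bar> \<le> (\<Sum>i=1..n. \<bar>x i\<bar>)"
proof -
  assume "s \<le> n"
  have "\<bar>walk x s\<bar> \<le> (\<Sum>i=1..s. \<bar>x i\<bar>)"
    unfolding walk_def by (rule sum_abs)
  also have "\<dots> \<le> (\<Sum>i=1..n. \<bar>x i\<bar>)"
    using \<open>s \<le> n\<close> by (intro sum_mono2) auto
  finally show ?thesis .
qed

lemma run_min_mem: "\<exists>s\<le>n. run_min x n = walk x s"
proof -
  have "run_min x n \<in> walk x ` {..n}" unfolding run_min_def by (rule Min_in) auto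
  then show ?thesis by blast
qed

lemma abs_run_min_le: "r \<le> n \<Longrightarrow> \<bar>run_min x r\<bar> \<le> (\<Sum>i=1..n. \<bar>x i\<bar>)"
  using run_min_mem[of r x] abs_walk_le[of _ n x] order_trans by metis

lemma abs_run_min_shift_le:
  assumes "r + n \<le> m"
  shows "\<bar>run_min (\<lambda>i. x (i + r)) n\<bar> \<le> (\<Sum>i=1..m. \<bar>x i\<bar>)"
proof -
  have "\<bar>run_min (\<lambda>i. x (i + r)) n\<bar> \<le> (\<Sum>i=1..n. \<bar>x (i + r)\<bar>)"
    by (rule abs_run_min_le) simp
  also have "\<dots> = (\<Sum>i=r+1..r+n. \<bar>x i\<bar>)"
    by (rule sum.reindex_bij_witness[of _ "\<lambda>i. i - r" "\<lambda>i. i + r"]) auto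
  also have "\<dots> \<le> (\<Sum>i=1..m. \<bar>x i\<bar>)"
    using assms by (intro sum_mono2) auto
  finally show ?thesis .
qed

text \<open>If the walk ends below zero, its minimum is not attained at the start, so that the first step
  may be split off.\<close>
lemma run_min_Suc_first_step:
  assumes "walk x (Suc n) < 0"
  shows "run_min x (Suc n) = x 1 + run_min (\<lambda>i. x (i + 1)) n"
proof -
  have "tail_min (Suc n) x 1 < 0"
    using tail_min_le[of 1 "Suc n" "Suc n" x] assms by simp
  moreover have "run_min x 1 = min 0 (walk x 1)"
    using run_min_Suc[of x 0] by simp
  moreover have "tail_min (Suc n) x 1 \<le> walk x 1"
    by (rule tail_min_le) auto
  ultimately have "run_min x (Suc n) = tail_min (Suc n) x 1"
    using run_min_split[of 1 "Suc n" x] by simp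
  then show ?thesis
    using tail_min_conv_run_min[of 1 "Suc n" x] by (simp add: walk_Suc)
qed

section \<open>Expectations for integrable steps of mean zero\<close>

context
  fixes p :: "int pmf"
  assumes int_p: "integrable (measure_pmf p) real_of_int"
    and mean_p: "measure_pmf.expectation p real_of_int = 0"
begin

lemma integrable_iid_pmf:
  assumes "\<And>x. \<bar>f x\<bar> \<le> (\<Sum>i=1..n. \<bar>x i\<bar>)"
  shows "integrable (measure_pmf (iid_pmf p n)) (\<lambda>x. real_of_int (f x))"
proof (rule Bochner_Integration.integrable_bound)
  show "integrable (measure_pmf (iid_pmf p n)) (\<lambda>x. \<Sum>i=1..n. \<bar>real_of_int (x i)\<bar>)"
    unfolding iid_pmf_def using int_p by (intro integrable_sum_Pi_pmf) auto
  have "\<bar>real_of_int (f x)\<bar> \<le> (\<Sum>i=1..n. \<bar>real_of_int (x i)\<bar>)" for x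
    using assms[of x] by (simp flip: of_int_abs of_int_sum)
  then show "AE x in measure_pmf (iid_pmf p n).
      norm (real_of_int (f x)) \<le> norm (\<Sum>i=1..n. \<bar>real_of_int (x i)\<bar>)"
    by (simp add: abs_of_nonneg sum_nonneg)
qed simp

lemma expectation_walk:
  "r \<le> n \<Longrightarrow> measure_pmf.expectation (iid_pmf p n) (\<lambda>x. real_of_int (walk x r)) = 0"
proof -
  have *: "measure_pmf.expectation (iid_pmf p r) (\<lambda>x. real_of_int (walk x r)) = 0"
    unfolding iid_pmf_def walk_def of_int_sum using int_p mean_p
    by (subst expectation_sum_Pi_pmf) auto
  assume "r \<le> n"
  then have "iid_pmf p r = map_pmf (\<lambda>x i. if i \<in> {1..r} then x (i + 0) else 0) (iid_pmf p n)"
    by (intro map_iid_pmf_shift[symmetric]) simp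
  then have "measure_pmf.expectation (iid_pmf p r) (\<lambda>x. real_of_int (walk x r))
      = measure_pmf.expectation (iid_pmf p n)
          (\<lambda>x. real_of_int (walk (\<lambda>i. if i \<in> {1..r} then x (i + 0) else 0) r))"
    by simp
  also have "(\<lambda>x. walk (\<lambda>i. if i \<in> {1..r} then x (i + 0) else 0) r) = (\<lambda>x. walk x r)"
    by (intro ext walk_cong) auto
  finally show ?thesis using * by simp
qed

lemma expectation_run_min_shift:
  assumes "r + n \<le> m"
  shows "measure_pmf.expectation (iid_pmf p m) (\<lambda>x. real_of_int (run_min (\<lambda>i. x (i + r)) n))
       = measure_pmf.expectation (iid_pmf p n) (\<lambda>x. real_of_int (run_min x n))"
proof -
  have "measure_pmf.expectation (iid_pmf p n) (\<lambda>x. real_of_int (run_min x n))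
      = measure_pmf.expectation (iid_pmf p m)
          (\<lambda>x. real_of_int (run_min (\<lambda>i. if i \<in> {1..n} then x (i + r) else 0) n))"
    by (subst map_iid_pmf_shift[OF assms, symmetric]) simp
  also have "(\<lambda>x. run_min (\<lambda>i. if i \<in> {1..n} then x (i + r) else 0) n)
      = (\<lambda>x. run_min (\<lambda>i. x (i + r)) n)"
    by (intro ext run_min_cong) auto
  finally show ?thesis ..
qed

text \<open>The event that the walk ends below zero is invariant under permuting the steps, so all
  \<open>n + 1\<close> steps have the same expectation on it. Their sum there is the endpoint
  itself, that is \<open>min 0 (walk x (Suc n))\<close>.\<close>

lemma expectation_first_step_on_negative:
  "measure_pmf.expectation (iid_pmf p (Suc n))
     (\<lambda>x. real_of_int (if walk x (Suc n) < 0 then x 1 else 0))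
   = measure_pmf.expectation (iid_pmf p (Suc n)) (\<lambda>x. real_of_int (min 0 (walk x (Suc n)))) / real (Suc n)"
proof -
  let ?Q = "iid_pmf p (Suc n)"
  define g where "g i x = (if walk x (Suc n) < 0 then x i else 0)" for i and x :: "nat \<Rightarrow> int"
  have eq: "measure_pmf.expectation ?Q (\<lambda>x. real_of_int (g i x))
      = measure_pmf.expectation ?Q (\<lambda>x. real_of_int (g 1 x))" if i: "i \<in> {1..Suc n}" for i
  proof -
    \<comment> \<open>Swapping the steps \<open>1\<close> and \<open>i\<close> turns
      \<open>g 1\<close> into \<open>g i\<close>.\<close>
    have \<pi>: "Transposition.transpose 1 i permutes {1..Suc n}"
      using i by (intro permutes_swap_id) auto
    have "measure_pmf.expectation ?Q (\<lambda>x. real_of_int (g 1 x))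
        = measure_pmf.expectation ?Q (\<lambda>x. real_of_int (g 1 (x \<circ> Transposition.transpose 1 i)))"
      by (subst map_iid_pmf_permute[OF \<pi>, symmetric]) simp
    also have "(\<lambda>x. g 1 (x \<circ> Transposition.transpose 1 i)) = g i"
      unfolding g_def fun_eq_iff walk_permute[OF \<pi>] by simp
    finally show ?thesis ..
  qed
  have int: "integrable (measure_pmf ?Q) (\<lambda>x. real_of_int (g i x))" if "i \<in> {1..Suc n}" for i
  proof (rule integrable_iid_pmf)
    fix x :: "nat \<Rightarrow> int"
    have "\<bar>g i x\<bar> \<le> \<bar>x i\<bar>" by (simp add: g_def)
    also have "\<dots> \<le> (\<Sum>i=1..Suc n. \<bar>x i\<bar>)"
      using that by (intro member_le_sum) auto
    finally show "\<bar>g i x\<bar> \<le> (\<Sum>i=1..Suc n. \<bar>x i\<bar>)" .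
  qed
  have "min 0 (walk x (Suc n)) = (\<Sum>i=1..Suc n. g i x)" for x
    by (simp add: g_def walk_def)
  then have "measure_pmf.expectation ?Q (\<lambda>x. real_of_int (min 0 (walk x (Suc n))))
      = (\<Sum>i=1..Suc n. measure_pmf.expectation ?Q (\<lambda>x. real_of_int (g i x)))"
    using int by (simp only: of_int_sum) (rule Bochner_Integration.integral_sum)
  also have "\<dots> = (\<Sum>i=1..Suc n. measure_pmf.expectation ?Q (\<lambda>x. real_of_int (g 1 x)))"
    using eq by (rule sum.cong[OF refl])
  also have "\<dots> = real (Suc n) * measure_pmf.expectation ?Q (\<lambda>x. real_of_int (g 1 x))"
    by simp
  finally have "measure_pmf.expectation ?Q (\<lambda>x. real_of_int (g 1 x))
      = measure_pmf.expectation ?Q (\<lambda>x. real_of_int (min 0 (walk x (Suc n)))) / real (Suc n)"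
    by (simp add: field_simps del: of_nat_Suc)
  then show ?thesis
    unfolding g_def .
qed

text \<open>A cyclic rotation of the steps preserves both their law and the endpoint, and it moves
  the steps \<open>2..n+1\<close> to the places \<open>1..n\<close>.\<close>

lemma expectation_shift_on_negative:
  "measure_pmf.expectation (iid_pmf p (Suc n))
     (\<lambda>x. real_of_int (if walk x (Suc n) < 0 then run_min (\<lambda>i. x (i + 1)) n else 0))
   = measure_pmf.expectation (iid_pmf p (Suc n))
     (\<lambda>x. real_of_int (if walk x (Suc n) < 0 then run_min x n else 0))"
proof -
  let ?Q = "iid_pmf p (Suc n)"
  define \<pi> where "\<pi> i = (if i = Suc n then 1 else if i \<in> {1..n} then i + 1 else i)" for i
  have "bij_betw \<pi> {1..Suc n} {1..Suc n}"
    by (rule bij_betwI[where g = "\<lambda>i. if i = 1 then Suc n else i - 1"]) (auto simp: \<pi>_def)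
  then have \<pi>: "\<pi> permutes {1..Suc n}"
    by (rule bij_imp_permutes) (auto simp: \<pi>_def)
  have "run_min (x \<circ> \<pi>) n = run_min (\<lambda>i. x (i + 1)) n" for x
    by (intro run_min_cong) (auto simp: \<pi>_def)
  then have "(\<lambda>x. if walk x (Suc n) < 0 then run_min (\<lambda>i. x (i + 1)) n else 0)
      = (\<lambda>x. if walk (x \<circ> \<pi>) (Suc n) < 0 then run_min (x \<circ> \<pi>) n else 0)"
    by (simp only: walk_permute[OF \<pi>])
  then show ?thesis
    by (subst (2) map_iid_pmf_permute[OF \<pi>, symmetric]) (simp add: fun_eq_iff)
qed

text \<open>If the walk ends at or above zero, the last step does not change the minimum. Otherwise
  the first step splits off, and by rotation the minimum of the remaining \<open>n\<close> steps has
  the same expectation on this event as that of the first \<open>n\<close>. The difference of the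
  two expectations is therefore that of the first step on the event.\<close>

lemma spitzer_run_min:
  "measure_pmf.expectation (iid_pmf p (Suc n)) (\<lambda>x. real_of_int (run_min x (Suc n)))
   = measure_pmf.expectation (iid_pmf p n) (\<lambda>x. real_of_int (run_min x n))
     - measure_pmf.expectation (iid_pmf p (Suc n)) (\<lambda>x. real_of_int \<bar>walk x (Suc n)\<bar>) / (2 * real (Suc n))"
proof -
  let ?Q = "iid_pmf p (Suc n)"
  let ?W = "\<lambda>x. walk x (Suc n)"
  define f1 f2 f3 f4 where "f1 x = (if ?W x < 0 then x 1 else 0)"
    and "f2 x = (if ?W x < 0 then run_min (\<lambda>i. x (i + 1)) n else 0)"
    and "f3 x = (if ?W x < 0 then run_min x n else 0)"
    and "f4 x = run_min x n" for x
  let ?E = "\<lambda>f. measure_pmf.expectation ?Q (\<lambda>x. real_of_int (f x))"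
  have shift_le: "\<bar>run_min (\<lambda>i. x (i + 1)) n\<bar> \<le> (\<Sum>i=1..Suc n. \<bar>x i\<bar>)" for x
    by (rule abs_run_min_shift_le) simp
  have nn: "0 \<le> (\<Sum>i=1..Suc n. \<bar>x i\<bar>)" for x :: "nat \<Rightarrow> int" by (intro sum_nonneg) auto
  have int: "integrable (measure_pmf ?Q) (\<lambda>x. real_of_int (f1 x))"
    "integrable (measure_pmf ?Q) (\<lambda>x. real_of_int (f2 x))"
    "integrable (measure_pmf ?Q) (\<lambda>x. real_of_int (f3 x))"
    "integrable (measure_pmf ?Q) (\<lambda>x. real_of_int (f4 x))"
    "integrable (measure_pmf ?Q) (\<lambda>x. real_of_int (?W x))"
    "integrable (measure_pmf ?Q) (\<lambda>x. real_of_int \<bar>?W x\<bar>)"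
  proof (safe intro!: integrable_iid_pmf)
    fix x :: "nat \<Rightarrow> int"
    let ?B = "\<Sum>i=1..Suc n. \<bar>x i\<bar>"
    have "\<bar>x 1\<bar> \<le> ?B" by (rule member_le_sum) auto
    then show "\<bar>f1 x\<bar> \<le> ?B" using nn[of x] by (simp only: f1_def split: if_split) simp
    show "\<bar>f2 x\<bar> \<le> ?B" using nn[of x] shift_le[of x] by (simp only: f2_def split: if_split) simp
    have *: "\<bar>run_min x n\<bar> \<le> ?B" by (rule abs_run_min_le) simp
    then show "\<bar>f3 x\<bar> \<le> ?B" using nn[of x] by (simp only: f3_def split: if_split) simp
    show "\<bar>f4 x\<bar> \<le> ?B" using * by (simp only: f4_def)
    show "\<bar>?W x\<bar> \<le> ?B" by (rule abs_walk_le) simp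
    then show "\<bar>\<bar>?W x\<bar>\<bar> \<le> ?B" by (simp only: abs_idempotent)
  qed
  have split: "run_min x (Suc n) = f1 x + f2 x + f4 x - f3 x" for x
    using run_min_Suc_first_step[of x n] run_min_le[of 0 n x]
    by (auto simp: f1_def f2_def f3_def f4_def run_min_Suc)
  have "?E (\<lambda>x. run_min x (Suc n)) = ?E f1 + ?E f2 + ?E f4 - ?E f3"
    unfolding split using int(1-4) by (simp add: f1_def f2_def f3_def f4_def)
  also have "?E f2 = ?E f3"
    unfolding f2_def f3_def by (rule expectation_shift_on_negative)
  also have "?E f4 = measure_pmf.expectation (iid_pmf p n) (\<lambda>x. real_of_int (run_min x n))"
    using expectation_run_min_shift[of 0 n "Suc n"] by (simp add: f4_def)
  also have "?E f1 = ?E (\<lambda>x. min 0 (?W x)) / real (Suc n)"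
    unfolding f1_def by (rule expectation_first_step_on_negative)
  also have "?E (\<lambda>x. min 0 (?W x)) = ?E (\<lambda>x. - \<bar>?W x\<bar>) / 2"
  proof -
    \<comment> \<open>The negative part is half of \<open>w - \<bar>w\<bar>\<close>, and the
      endpoint has mean zero.\<close>
    have "real_of_int (min 0 (?W x)) = (real_of_int (?W x) - real_of_int \<bar>?W x\<bar>) / 2" for x
      by (simp add: min_def)
    then have "?E (\<lambda>x. min 0 (?W x)) = (?E ?W - ?E (\<lambda>x. \<bar>?W x\<bar>)) / 2"
      using int(5,6) by (simp only: integral_divide_zero Bochner_Integration.integral_diff)
    then show ?thesis
      using expectation_walk[of "Suc n" "Suc n"] by simp
  qed
  finally show ?thesis
    by (simp add: field_simps)
qed

end

section \<open>The mean absolute displacement\<close>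

text \<open>The cross terms vanish by independence and zero means. Integrability is part of the
  induction because the expansion of the next square needs it.\<close>

lemma (in prob_space) second_moment_sum_indep:
  fixes X :: "'i \<Rightarrow> 'a \<Rightarrow> real"
  assumes "finite I" "indep_vars (\<lambda>_. borel) X I"
    and "\<And>i. i \<in> I \<Longrightarrow> integrable M (\<lambda>\<omega>. (X i \<omega>)\<^sup>2)" "\<And>i. i \<in> I \<Longrightarrow> expectation (X i) = 0"
  shows "integrable M (\<lambda>\<omega>. (\<Sum>i\<in>I. X i \<omega>)\<^sup>2) \<and>
         expectation (\<lambda>\<omega>. (\<Sum>i\<in>I. X i \<omega>)\<^sup>2) = (\<Sum>i\<in>I. expectation (\<lambda>\<omega>. (X i \<omega>)\<^sup>2))"
  using assms
proof (induction I rule: finite_induct)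
  case (insert i I)
  let ?S = "\<lambda>\<omega>. \<Sum>i\<in>I. X i \<omega>"
  have IH: "integrable M (\<lambda>\<omega>. (?S \<omega>)\<^sup>2)"
    "expectation (\<lambda>\<omega>. (?S \<omega>)\<^sup>2) = (\<Sum>i\<in>I. expectation (\<lambda>\<omega>. (X i \<omega>)\<^sup>2))"
    using insert.IH insert.prems indep_vars_subset[OF insert.prems(1), of I] by auto
  have rv [measurable]: "random_variable borel (X j)" if "j \<in> insert i I" for j
    using insert.prems(1) that unfolding indep_vars_def2 by auto
  have meas: "?S \<in> borel_measurable M" using rv by (intro borel_measurable_sum) blast
  have int_X: "integrable M (X i)"
    by (rule square_integrable_imp_integrable[OF rv insert.prems(2)]) simp_all
  have int_S: "integrable M ?S"
    using meas IH(1) by (rule square_integrable_imp_integrable)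
  have ind: "indep_var borel (X i) borel ?S"
    using insert by (intro indep_vars_sum) auto
  have prod: "integrable M (\<lambda>\<omega>. X i \<omega> * ?S \<omega>)" "expectation (\<lambda>\<omega>. X i \<omega> * ?S \<omega>) = 0"
    using indep_var_integrable[OF ind int_X int_S] indep_var_lebesgue_integral[OF ind int_X int_S]
      insert.prems(3)[of i] by simp_all
  have eq: "(\<Sum>i\<in>insert i I. X i \<omega>)\<^sup>2 = (X i \<omega>)\<^sup>2 + 2 * (X i \<omega> * ?S \<omega>) + (?S \<omega>)\<^sup>2" for \<omega>
    using insert.hyps by (simp add: power2_sum mult.assoc)
  have int: "integrable M (\<lambda>\<omega>. (X i \<omega>)\<^sup>2 + 2 * (X i \<omega> * ?S \<omega>))"
    using prod(1) insert.prems(2)[of i] by (intro Bochner_Integration.integrable_add) auto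
  have "expectation (\<lambda>\<omega>. (X i \<omega>)\<^sup>2 + 2 * (X i \<omega> * ?S \<omega>)) = expectation (\<lambda>\<omega>. (X i \<omega>)\<^sup>2)"
    using prod insert.prems(2)[of i] by (subst Bochner_Integration.integral_add) auto
  then show ?case
    unfolding eq
    using Bochner_Integration.integrable_add[OF int IH(1)]
      Bochner_Integration.integral_add[OF int IH(1)] IH(2) insert.hyps
    by (simp only: sum.insert) simp
qed simp

text \<open>The bound on second moments gives uniform integrability: \<open>\<bar>x\<bar> - min \<bar>x\<bar> K \<le> x\<^sup>2 / K\<close>.\<close>
lemma weak_conv_imp_abs_moment_conv:
  fixes \<mu> :: "nat \<Rightarrow> real measure" and M :: "real measure"
  assumes \<mu>: "\<And>n. real_distribution (\<mu> n)" and M: "real_distribution M"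
    and weak: "weak_conv_m \<mu> M"
    and sq_\<mu>: "\<And>n. integrable (\<mu> n) (\<lambda>x. x\<^sup>2)" "\<And>n. (\<integral>x. x\<^sup>2 \<partial>\<mu> n) \<le> C"
    and sq_M: "integrable M (\<lambda>x. x\<^sup>2)" "(\<integral>x. x\<^sup>2 \<partial>M) \<le> C"
  shows "(\<lambda>n. \<integral>x. \<bar>x\<bar> \<partial>\<mu> n) \<longlonglongrightarrow> (\<integral>x. \<bar>x\<bar> \<partial>M)"
proof -
  have trunc: "(\<integral>x. min \<bar>x\<bar> K \<partial>N) \<le> (\<integral>x. \<bar>x\<bar> \<partial>N) \<and>
      (\<integral>x. \<bar>x\<bar> \<partial>N) \<le> (\<integral>x. min \<bar>x\<bar> K \<partial>N) + C / K"
    if N: "real_distribution N" and sq: "integrable N (\<lambda>x. x\<^sup>2)" "(\<integral>x. x\<^sup>2 \<partial>N) \<le> C"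
      and K: "K > 0" for N K
  proof -
    interpret real_distribution N by fact
    have int: "integrable N (\<lambda>x. \<bar>x\<bar>)"
      by (rule integrable_abs, rule square_integrable_imp_integrable[OF _ sq(1)]) simp
    have int_min: "integrable N (\<lambda>x. min \<bar>x\<bar> K)"
      using K by (intro integrable_const_bound[where B = K]) auto
    have "(\<integral>x. \<bar>x\<bar> \<partial>N) \<le> (\<integral>x. min \<bar>x\<bar> K + x\<^sup>2 / K \<partial>N)"
    proof (rule integral_mono)
      fix x :: real
      show "\<bar>x\<bar> \<le> min \<bar>x\<bar> K + x\<^sup>2 / K"
      proof (cases "\<bar>x\<bar> \<le> K")
        case False
        then have "\<bar>x\<bar> * K \<le> x\<^sup>2"
          unfolding power2_eq_square abs_mult_self[symmetric, of x] by (intro mult_left_mono) auto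
        then have "\<bar>x\<bar> \<le> x\<^sup>2 / K" using K by (simp add: field_simps)
        then show ?thesis using K by simp
      qed (use K in auto)
    qed (use int int_min sq in auto)
    also have "\<dots> = (\<integral>x. min \<bar>x\<bar> K \<partial>N) + (\<integral>x. x\<^sup>2 \<partial>N) / K"
      using int_min sq by simp
    also have "\<dots> \<le> (\<integral>x. min \<bar>x\<bar> K \<partial>N) + C / K"
      using sq(2) K by (simp add: divide_right_mono)
    finally show ?thesis
      using int int_min by (auto intro: integral_mono)
  qed
  have "C \<ge> 0"
    using order_trans[OF _ sq_M(2)] by (simp add: integral_nonneg_AE)
  show ?thesis
  proof (rule LIMSEQ_I)
    fix e :: real assume e: "e > 0"
    \<comment> \<open>Truncation costs at most \<open>C / K\<close> for each of the two measures, so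
      \<open>2 * C / K < e\<close> is needed; the summand \<open>1\<close> keeps \<open>K\<close>
      positive when \<open>C = 0\<close>.\<close>
    define K where "K = (2 * C + 1) / e"
    have K: "K > 0" "2 * (C / K) < e"
      using e \<open>C \<ge> 0\<close> by (auto simp: K_def field_simps)
    have "(\<lambda>n. \<integral>x. min \<bar>x\<bar> K \<partial>\<mu> n) \<longlonglongrightarrow> (\<integral>x. min \<bar>x\<bar> K \<partial>M)"
      using K by (intro weak_conv_imp_integral_bdd_continuous_conv[OF \<mu> M weak, where B = K])
        (auto intro!: continuous_intros)
    moreover have "e - 2 * (C / K) > 0" using K by simp
    ultimately obtain n0 where n0: "\<And>n. n \<ge> n0 \<Longrightarrow>
        norm ((\<integral>x. min \<bar>x\<bar> K \<partial>\<mu> n) - (\<integral>x. min \<bar>x\<bar> K \<partial>M)) < e - 2 * (C / K)"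
      using LIMSEQ_D by blast
    have "norm ((\<integral>x. \<bar>x\<bar> \<partial>\<mu> n) - (\<integral>x. \<bar>x\<bar> \<partial>M)) < e" if "n \<ge> n0" for n
    proof -
      have "0 \<le> C / K" using K \<open>C \<ge> 0\<close> by simp
      then show ?thesis
        using n0[OF that] trunc[OF \<mu>[of n] sq_\<mu> K(1)] trunc[OF M sq_M K(1)]
        unfolding real_norm_def by linarith
    qed
    then show "\<exists>n0. \<forall>n\<ge>n0. norm ((\<integral>x. \<bar>x\<bar> \<partial>\<mu> n) - (\<integral>x. \<bar>x\<bar> \<partial>M)) < e"
      by blast
  qed
qed

text \<open>The central limit theorem concerns one infinite sequence on a fixed space, whereas
  \<open>iid_pmf p n\<close> varies with \<open>n\<close>. The walk is therefore transferred to an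
  infinite product: on both spaces the characteristic function of the sum is the \<open>n\<close>-th
  power of that of a single step, and Levy uniqueness identifies the laws.\<close>

lemma distr_walk_eq_distr_PiM:
  "distr (PiM UNIV (\<lambda>_::nat. measure_pmf p)) borel (\<lambda>\<omega>. \<Sum>i<n. real_of_int (\<omega> i))
   = distr (measure_pmf (iid_pmf p n)) borel (\<lambda>x. real_of_int (walk x n))"
  and indep_vars_PiM_coordinates:
  "prob_space.indep_vars (PiM UNIV (\<lambda>_::nat. measure_pmf p)) (\<lambda>_. borel)
     (\<lambda>i \<omega>. real_of_int (\<omega> i)) UNIV"
  and distr_PiM_coordinate:
  "distr (PiM UNIV (\<lambda>_::nat. measure_pmf p)) borel (\<lambda>\<omega>. real_of_int (\<omega> i))
   = distr (measure_pmf p) borel real_of_int"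
proof -
  interpret product_prob_space "\<lambda>_::nat. measure_pmf p" UNIV
    by unfold_locales
  let ?P = "PiM UNIV (\<lambda>_::nat. measure_pmf p)"
  have comp: "distr ?P (measure_pmf p) (\<lambda>\<omega>. \<omega> i) = measure_pmf p" for i
    by (rule distr_PiM_component) (auto intro: measure_pmf.prob_space_axioms)
  have meas [measurable]: "(\<lambda>\<omega>. \<omega> i) \<in> measurable ?P (measure_pmf p)" for i
    by (rule measurable_component_singleton) simp
  have "prob_space.indep_vars ?P (\<lambda>_. measure_pmf p) (\<lambda>i \<omega>. \<omega> i) UNIV"
    by (subst P.indep_vars_iff_distr_eq_PiM) (auto simp: comp restrict_UNIV distr_id)
  then show ind: "prob_space.indep_vars ?P (\<lambda>_. borel) (\<lambda>i \<omega>. real_of_int (\<omega> i)) UNIV"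
    by (rule P.indep_vars_compose2) simp
  show coord: "distr ?P borel (\<lambda>\<omega>. real_of_int (\<omega> i)) = distr (measure_pmf p) borel real_of_int" for i
    by (subst comp[of i, symmetric], subst distr_distr) (auto simp: o_def)
  let ?Q = "measure_pmf (iid_pmf p n)"
  have indQ: "prob_space.indep_vars ?Q (\<lambda>_. borel) (\<lambda>i x. real_of_int (x i)) {1..n}"
    unfolding iid_pmf_def
    by (rule prob_space.indep_vars_compose2[OF measure_pmf.prob_space_axioms indep_vars_Pi_pmf]) auto
  have coordQ: "distr ?Q borel (\<lambda>x. real_of_int (x i)) = distr (measure_pmf p) borel real_of_int"
    if "i \<in> {1..n}" for i
  proof -
    have "map_pmf (\<lambda>x. x i) (iid_pmf p n) = p"
      using that by (simp add: iid_pmf_def Pi_pmf_component)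
    moreover have "distr (measure_pmf (map_pmf (\<lambda>x. x i) (iid_pmf p n))) borel real_of_int
        = distr ?Q borel (\<lambda>x. real_of_int (x i))"
      by (simp add: map_pmf_rep_eq distr_distr o_def)
    ultimately show ?thesis by (simp only:)
  qed
  have "char (distr ?P borel (\<lambda>\<omega>. \<Sum>i<n. real_of_int (\<omega> i))) t
      = char (distr ?Q borel (\<lambda>x. real_of_int (walk x n))) t" for t
  proof -
    have "char (distr ?P borel (\<lambda>\<omega>. \<Sum>i<n. real_of_int (\<omega> i))) t
        = char (distr (measure_pmf p) borel real_of_int) t ^ n"
      using P.char_distr_sum[OF P.indep_vars_subset[OF ind], of "{..<n}" t]
      by (simp add: coord)
    moreover have "char (distr ?Q borel (\<lambda>x. \<Sum>i=1..n. real_of_int (x i))) t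
        = char (distr (measure_pmf p) borel real_of_int) t ^ n"
      using prob_space.char_distr_sum[OF measure_pmf.prob_space_axioms indQ, of t] coordQ by simp
    ultimately show ?thesis by (simp add: walk_def)
  qed
  then show "distr ?P borel (\<lambda>\<omega>. \<Sum>i<n. real_of_int (\<omega> i))
      = distr ?Q borel (\<lambda>x. real_of_int (walk x n))"
    by (intro Levy_uniqueness) (auto intro!: P.real_distribution_distr prob_space.real_distribution_distr[OF measure_pmf.prob_space_axioms])
qed

lemma expectation_walk_sq:
  assumes "integrable (measure_pmf p) (\<lambda>k. (real_of_int k)\<^sup>2)"
    and "measure_pmf.expectation p real_of_int = 0"
  shows "integrable (measure_pmf (iid_pmf p n)) (\<lambda>x. (real_of_int (walk x n))\<^sup>2)" (is ?int)
    and "measure_pmf.expectation (iid_pmf p n) (\<lambda>x. (real_of_int (walk x n))\<^sup>2)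
       = real n * measure_pmf.expectation p (\<lambda>k. (real_of_int k)\<^sup>2)" (is ?eq)
proof -
  let ?Q = "iid_pmf p n"
  have ind: "prob_space.indep_vars (measure_pmf ?Q) (\<lambda>_. borel) (\<lambda>i x. real_of_int (x i)) {1..n}"
    unfolding iid_pmf_def
    by (rule prob_space.indep_vars_compose2[OF measure_pmf.prob_space_axioms indep_vars_Pi_pmf]) auto
  have proj: "map_pmf (\<lambda>x. x i) ?Q = p" if "i \<in> {1..n}" for i
    using that by (simp add: iid_pmf_def Pi_pmf_component)
  have "integrable (measure_pmf ?Q) (\<lambda>x. f (x i)) = integrable (measure_pmf p) f"
    "measure_pmf.expectation ?Q (\<lambda>x. f (x i)) = measure_pmf.expectation p f"
    if "i \<in> {1..n}" for i and f :: "int \<Rightarrow> real"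
    using integrable_map_pmf_eq[of "\<lambda>x. x i" ?Q f] integral_map_pmf[of "\<lambda>x. x i" ?Q f]
    unfolding proj[OF that] by simp_all
  note coord = this[of _ real_of_int] this[of _ "\<lambda>k. (real_of_int k)\<^sup>2"]
  then show ?int ?eq
    using prob_space.second_moment_sum_indep[OF measure_pmf.prob_space_axioms _ ind] assms
    by (simp_all add: walk_def coord)
qed

text \<open>The walk divided by \<open>\<sigma> * sqrt n\<close> converges weakly to the standard
  normal law with second moments at most \<open>1\<close>, so its first absolute moments converge to
  the Gaussian one, \<open>sqrt (2 / pi)\<close>.\<close>

lemma abs_walk_asymp:
  assumes sq: "integrable (measure_pmf p) (\<lambda>k. (real_of_int k)\<^sup>2)"
    and mean: "measure_pmf.expectation p real_of_int = 0"
    and var: "measure_pmf.expectation p (\<lambda>k. (real_of_int k)\<^sup>2) = \<sigma>\<^sup>2" and \<sigma>: "\<sigma> > 0"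
  shows "(\<lambda>n. measure_pmf.expectation (iid_pmf p n) (\<lambda>x. real_of_int \<bar>walk x n\<bar>) / sqrt (real n))
           \<longlonglongrightarrow> \<sigma> * sqrt (2 / pi)"
proof -
  let ?P = "PiM UNIV (\<lambda>_::nat. measure_pmf p)"
  interpret product_prob_space "\<lambda>_::nat. measure_pmf p" UNIV
    by unfold_locales
  define s where "s n = sqrt (real n * \<sigma>\<^sup>2)" for n
  define \<mu> where "\<mu> n = distr (measure_pmf (iid_pmf p n)) borel (\<lambda>x. real_of_int (walk x n) / s n)" for n
  have rv: "(\<lambda>\<omega>. real_of_int (\<omega> i)) \<in> borel_measurable ?P" for i
    using indep_vars_PiM_coordinates[of p] by (simp add: P.indep_vars_def2)
  have coord_int: "integrable ?P (\<lambda>\<omega>. f (real_of_int (\<omega> i))) \<longleftrightarrow> integrable (measure_pmf p) (\<lambda>k. f (real_of_int k))"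
    and coord_exp: "P.expectation (\<lambda>\<omega>. f (real_of_int (\<omega> i))) = measure_pmf.expectation p (\<lambda>k. f (real_of_int k))"
    if [measurable]: "f \<in> borel_measurable borel" for f :: "real \<Rightarrow> real" and i
    using integrable_distr_eq[OF rv that, of i] integral_distr[OF rv that, of i]
      integrable_distr_eq[of real_of_int "measure_pmf p" borel f] integral_distr[of real_of_int "measure_pmf p" borel f]
    by (simp_all add: distr_PiM_coordinate)
  have "weak_conv_m (\<lambda>n. distr ?P borel (\<lambda>\<omega>. (\<Sum>i<n. real_of_int (\<omega> i)) / sqrt (real n * \<sigma>\<^sup>2)))
      std_normal_distribution"
    using coord_int[of "\<lambda>x. x\<^sup>2"] coord_exp[of "\<lambda>x. x"] coord_exp[of "\<lambda>x. x\<^sup>2"] sq mean var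
    by (intro P.central_limit_theorem_zero_mean[where \<mu> = "distr (measure_pmf p) borel real_of_int"]
        indep_vars_PiM_coordinates distr_PiM_coordinate \<sigma>) simp_all
  also have "(\<lambda>n. distr ?P borel (\<lambda>\<omega>. (\<Sum>i<n. real_of_int (\<omega> i)) / sqrt (real n * \<sigma>\<^sup>2))) = \<mu>"
  proof
    fix n
    have "distr ?P borel (\<lambda>\<omega>. (\<Sum>i<n. real_of_int (\<omega> i)) / s n)
        = distr (distr ?P borel (\<lambda>\<omega>. \<Sum>i<n. real_of_int (\<omega> i))) borel (\<lambda>y. y / s n)"
      using rv by (subst distr_distr) (auto simp: o_def)
    also have "\<dots> = \<mu> n"
      unfolding distr_walk_eq_distr_PiM \<mu>_def by (subst distr_distr) (auto simp: o_def)
    finally show "distr ?P borel (\<lambda>\<omega>. (\<Sum>i<n. real_of_int (\<omega> i)) / sqrt (real n * \<sigma>\<^sup>2)) = \<mu> n"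
      by (simp add: s_def)
  qed
  finally have weak: "weak_conv_m \<mu> std_normal_distribution" .
  have "(\<lambda>n. \<integral>y. \<bar>y\<bar> \<partial>\<mu> n) \<longlonglongrightarrow> (\<integral>y. \<bar>y\<bar> \<partial>std_normal_distribution)"
  proof (rule weak_conv_imp_abs_moment_conv[OF _ real_dist_normal_dist weak, where C = 1])
    fix n
    show "real_distribution (\<mu> n)"
      unfolding \<mu>_def by (rule prob_space.real_distribution_distr[OF measure_pmf.prob_space_axioms]) simp
    have s2: "(s n)\<^sup>2 = real n * \<sigma>\<^sup>2" by (simp add: s_def)
    show "integrable (\<mu> n) (\<lambda>y. y\<^sup>2)"
      unfolding \<mu>_def using expectation_walk_sq(1)[OF sq mean, of n]
      by (subst integrable_distr_eq) (simp_all add: power_divide)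
    have "(\<integral>y. y\<^sup>2 \<partial>\<mu> n) = real n * \<sigma>\<^sup>2 / (s n)\<^sup>2"
      unfolding \<mu>_def using expectation_walk_sq(2)[OF sq mean, of n] var
      by (subst integral_distr) (simp_all add: power_divide)
    \<comment> \<open>Only an inequality, because for \<open>n = 0\<close> the quotient is
      \<open>0 / 0 = 0\<close>.\<close>
    also have "\<dots> \<le> 1" unfolding s2 by simp
    finally show "(\<integral>y. y\<^sup>2 \<partial>\<mu> n) \<le> 1" .
  qed (use std_normal_distribution_even_moments[of 1] in auto)
  moreover have "(\<integral>y. \<bar>y\<bar> \<partial>std_normal_distribution) = sqrt (2 / pi)"
    using std_normal_distribution_odd_moments_abs[of 0] by simp
  moreover have "(\<integral>y. \<bar>y\<bar> \<partial>\<mu> n)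
      = measure_pmf.expectation (iid_pmf p n) (\<lambda>x. real_of_int \<bar>walk x n\<bar>) / s n" for n
    unfolding \<mu>_def by (subst integral_distr) (simp_all add: s_def)
  ultimately have "(\<lambda>n. \<sigma> * (measure_pmf.expectation (iid_pmf p n) (\<lambda>x. real_of_int \<bar>walk x n\<bar>) / s n))
      \<longlonglongrightarrow> \<sigma> * sqrt (2 / pi)"
    by (intro tendsto_mult_left) simp
  then show ?thesis
    using \<sigma> by (simp add: s_def real_sqrt_mult)
qed

section \<open>Summation asymptotics\<close>

text \<open>From some \<open>N\<close> on, the increments of \<open>x - L * y\<close> are at most
  \<open>e / 2\<close> times those of \<open>y\<close>. Telescoping leaves an error of
  \<open>e / 2 * y n\<close> plus a constant, which the growth of \<open>y\<close> absorbs.\<close>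

lemma stolz_cesaro:
  fixes x y :: "nat \<Rightarrow> real"
  assumes mono: "\<And>n. y n < y (Suc n)"
    and top: "filterlim y at_top sequentially"
    and lim: "(\<lambda>n. (x (Suc n) - x n) / (y (Suc n) - y n)) \<longlonglongrightarrow> L"
  shows "(\<lambda>n. x n / y n) \<longlonglongrightarrow> L"
proof (rule LIMSEQ_I)
  fix e :: real assume "e > 0"
  then have "e / 2 > 0" by simp
  from LIMSEQ_D[OF lim this] obtain N where N:
    "\<And>n. n \<ge> N \<Longrightarrow> norm ((x (Suc n) - x n) / (y (Suc n) - y n) - L) < e / 2"
    by blast
  have incr: "\<bar>x (Suc n) - x n - L * (y (Suc n) - y n)\<bar> \<le> e / 2 * (y (Suc n) - y n)"
    if "n \<ge> N" for n
  proof -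
    have d: "y (Suc n) - y n > 0" using mono[of n] by simp
    have "\<bar>x (Suc n) - x n - L * (y (Suc n) - y n)\<bar>
        = \<bar>(x (Suc n) - x n) / (y (Suc n) - y n) - L\<bar> * (y (Suc n) - y n)"
      using d by (simp add: abs_mult_pos' field_simps flip: abs_mult_pos)
    also have "\<dots> \<le> e / 2 * (y (Suc n) - y n)"
      using N[OF that] d by (intro mult_right_mono) auto
    finally show ?thesis .
  qed
  have tele: "\<bar>x n - x N - L * (y n - y N)\<bar> \<le> e / 2 * (y n - y N)" if "n \<ge> N" for n
    using that
  proof (induction rule: dec_induct)
    case (step n)
    have "x (Suc n) - x N - L * (y (Suc n) - y N)
        = (x n - x N - L * (y n - y N)) + (x (Suc n) - x n - L * (y (Suc n) - y n))"
      by (simp add: algebra_simps)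
    also have "\<bar>\<dots>\<bar> \<le> e / 2 * (y n - y N) + e / 2 * (y (Suc n) - y n)"
      using step.IH incr[OF step.hyps(1)] by (intro order_trans[OF abs_triangle_ineq] add_mono)
    also have "\<dots> = e / 2 * (y (Suc n) - y N)"
      by (simp only: distrib_left[symmetric] diff_add_eq add_diff_eq) simp
    finally show ?case .
  qed simp
  \<comment> \<open>\<open>K\<close> collects the contributions of the index \<open>N\<close>; the
    absolute value of \<open>y N\<close> is taken since its sign is not known.\<close>
  define K where "K = \<bar>x N - L * y N\<bar> + e / 2 * \<bar>y N\<bar>"
  have "eventually (\<lambda>n. y n > max 1 (2 * K / e)) sequentially"
    using top unfolding filterlim_at_top_dense by blast
  moreover have "eventually (\<lambda>n. n \<ge> N) sequentially"
    by (rule eventually_ge_at_top)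
  ultimately have "eventually (\<lambda>n. norm (x n / y n - L) < e) sequentially"
  proof eventually_elim
    case (elim n)
    then have y: "y n > 0" and K: "K < e / 2 * y n"
      using \<open>e > 0\<close> by (simp_all add: field_simps)
    have ey: "- (e / 2 * y N) \<le> e / 2 * \<bar>y N\<bar>"
      using \<open>e > 0\<close> by (simp add: abs_if)
    have "x n - L * y n = (x N - L * y N) + (x n - x N - L * (y n - y N))"
      by (simp add: algebra_simps)
    also have "\<bar>\<dots>\<bar> \<le> \<bar>x N - L * y N\<bar> + e / 2 * (y n - y N)"
      using tele[of n] elim by (intro order_trans[OF abs_triangle_ineq] add_left_mono) simp
    also have "\<dots> \<le> K + e / 2 * y n"
      unfolding K_def right_diff_distrib using ey by linarith
    also have "\<dots> < e * y n" using K by linarith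
    finally have "\<bar>x n - L * y n\<bar> / y n < e"
      using y by (simp add: pos_divide_less_eq)
    moreover have "x n / y n - L = (x n - L * y n) / y n"
      using y by (simp add: field_simps)
    ultimately show ?case using y by simp
  qed
  then show "\<exists>N. \<forall>n\<ge>N. norm (x n / y n - L) < e"
    by (simp add: eventually_sequentially)
qed

text \<open>Stolz-Cesaro against \<open>sqrt n\<close>: both increments are of order
  \<open>1 / sqrt n\<close>, and \<open>sqrt (n + 1) - sqrt n\<close> behaves like
  \<open>1 / (2 * sqrt n)\<close>, which cancels the factor \<open>2\<close> in the
  recursion.\<close>

lemma sqrt_asymp_of_increments:
  fixes e a :: "nat \<Rightarrow> real"
  assumes rec: "\<And>n. e (Suc n) = e n + a (Suc n) / (2 * real (Suc n))"
    and lim: "(\<lambda>n. a n / sqrt n) \<longlonglongrightarrow> c"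
  shows "(\<lambda>n. e n / sqrt n) \<longlonglongrightarrow> c"
proof (rule stolz_cesaro)
  have "(\<lambda>n. a (Suc n) / sqrt (Suc n)) \<longlonglongrightarrow> c"
    using lim by (rule LIMSEQ_Suc)
  moreover have "(\<lambda>n. sqrt (real n + 1) / (2 * (real n + 1) * (sqrt (real n + 1) - sqrt (real n)))) \<longlonglongrightarrow> 1"
    by real_asymp
  ultimately have "(\<lambda>n. a (Suc n) / sqrt (Suc n) *
     (sqrt (real n + 1) / (2 * (real n + 1) * (sqrt (real n + 1) - sqrt (real n))))) \<longlonglongrightarrow> c * 1"
    by (rule tendsto_mult)
  moreover have "a (Suc n) / sqrt (Suc n) *
     (sqrt (real n + 1) / (2 * (real n + 1) * (sqrt (real n + 1) - sqrt (real n))))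
     = (e (Suc n) - e n) / (sqrt (real (Suc n)) - sqrt (real n))" for n
    by (simp add: rec add.commute)
  ultimately show "(\<lambda>n. (e (Suc n) - e n) / (sqrt (real (Suc n)) - sqrt (real n))) \<longlonglongrightarrow> c"
    by simp
  show "filterlim (\<lambda>n. sqrt (real n)) at_top sequentially" by real_asymp
qed simp

text \<open>The increments of \<open>n powr (3/2)\<close> behave like \<open>3/2 * sqrt n\<close>,
  whence the factor \<open>2/3\<close>.\<close>

lemma sum_of_sqrt_asymp:
  fixes e :: "nat \<Rightarrow> real"
  assumes lim: "(\<lambda>n. e n / sqrt n) \<longlonglongrightarrow> c"
  shows "(\<lambda>n. (\<Sum>r\<le>n. e r) / (real n powr (3 / 2))) \<longlonglongrightarrow> 2 / 3 * c"
proof (rule stolz_cesaro)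
  have "(\<lambda>n. e (Suc n) / sqrt (Suc n)) \<longlonglongrightarrow> c"
    using lim by (rule LIMSEQ_Suc)
  moreover have "(\<lambda>n. sqrt (real n + 1) / ((real n + 1) powr (3/2) - real n powr (3/2))) \<longlonglongrightarrow> 2 / 3"
    by real_asymp
  ultimately have "(\<lambda>n. e (Suc n) / sqrt (Suc n) *
     (sqrt (real n + 1) / ((real n + 1) powr (3/2) - real n powr (3/2)))) \<longlonglongrightarrow> c * (2 / 3)"
    by (rule tendsto_mult)
  then show "(\<lambda>n. ((\<Sum>r\<le>Suc n. e r) - (\<Sum>r\<le>n. e r)) /
      (real (Suc n) powr (3/2) - real n powr (3/2))) \<longlonglongrightarrow> 2 / 3 * c"
    by (simp add: add.commute mult.commute)
  show "filterlim (\<lambda>n. real n powr (3/2)) at_top sequentially" by real_asymp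
qed (simp add: powr_less_mono2)

text \<open>Reflecting \<open>r\<close> to \<open>m - r\<close> turns the sum into
  \<open>2 * (\<Sum>r\<le>m. e r) - (m + 1) * e m\<close>; the two parts contribute
  \<open>4/3 * c\<close> and \<open>- c\<close>.\<close>

lemma sum_excess_asymp:
  fixes e :: "nat \<Rightarrow> real"
  assumes lim: "(\<lambda>n. e n / sqrt n) \<longlonglongrightarrow> c"
  shows "(\<lambda>m. (\<Sum>r\<le>m. e r + e (m - r) - e m) / (real m powr (3 / 2))) \<longlonglongrightarrow> c / 3"
proof -
  have flip: "(\<Sum>r\<le>m. e (m - r)) = (\<Sum>r\<le>m. e r)" for m
    by (rule sum.reindex_bij_witness[of _ "\<lambda>r. m - r" "\<lambda>r. m - r"]) auto
  have "(\<lambda>m. real (Suc m) * sqrt m / real m powr (3/2)) \<longlonglongrightarrow> 1"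
    by real_asymp
  then have "(\<lambda>m. 2 * ((\<Sum>r\<le>m. e r) / (real m powr (3 / 2)))
      - e m / sqrt m * (real (Suc m) * sqrt m / real m powr (3/2))) \<longlonglongrightarrow> 2 * (2 / 3 * c) - c * 1"
    using lim by (intro tendsto_intros sum_of_sqrt_asymp)
  moreover have "eventually (\<lambda>m. 2 * ((\<Sum>r\<le>m. e r) / (real m powr (3 / 2)))
      - e m / sqrt m * (real (Suc m) * sqrt m / real m powr (3/2))
      = (\<Sum>r\<le>m. e r + e (m - r) - e m) / (real m powr (3 / 2))) sequentially"
    using eventually_gt_at_top[of 0]
    by eventually_elim (simp add: sum.distrib sum_subtractf flip diff_divide_distrib add_divide_distrib)
  ultimately show ?thesis
    by (simp add: tendsto_cong)
qed

section \<open>The expectation of \<open>\<beta>\<close>\<close>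

text \<open>Zipping is injective, so the mass of a zipped vector is the product of the masses of its
  two components, and this product can be regrouped coordinate by coordinate. Applying
  \<open>h\<close> then acts on each coordinate separately.\<close>

lemma map_pair_Pi_pmf:
  fixes p :: "'a \<Rightarrow> 'c pmf" and q :: "'a \<Rightarrow> 'd pmf"
  assumes "finite I"
  shows "map_pmf (\<lambda>(f, g) i. h (f i) (g i)) (pair_pmf (Pi_pmf I d p) (Pi_pmf I d' q))
       = Pi_pmf I (h d d') (\<lambda>i. map_pmf (\<lambda>(a, b). h a b) (pair_pmf (p i) (q i)))"
proof -
  let ?zip = "\<lambda>(f, g) i. (f i, g i)"
  have "map_pmf ?zip (pair_pmf (Pi_pmf I d p) (Pi_pmf I d' q))
      = Pi_pmf I (d, d') (\<lambda>i. pair_pmf (p i) (q i))"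
  proof (rule pmf_eqI)
    fix k :: "'a \<Rightarrow> 'c \<times> 'd"
    have inj: "inj ?zip" by (auto simp: inj_on_def fun_eq_iff)
    have k: "?zip (fst \<circ> k, snd \<circ> k) = k" by (simp add: fun_eq_iff)
    have "pmf (map_pmf ?zip (pair_pmf (Pi_pmf I d p) (Pi_pmf I d' q))) k
        = pmf (pair_pmf (Pi_pmf I d p) (Pi_pmf I d' q)) (fst \<circ> k, snd \<circ> k)"
      using pmf_map_inj'[OF inj, of _ "(fst \<circ> k, snd \<circ> k)"] unfolding k .
    also have "\<dots> = pmf (Pi_pmf I (d, d') (\<lambda>i. pair_pmf (p i) (q i))) k"
    proof -
      have "pmf (pair_pmf (p i) (q i)) (k i) = pmf (p i) (fst (k i)) * pmf (q i) (snd (k i))" for i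
        using pmf_pair[of "p i" "q i" "fst (k i)" "snd (k i)"] by simp
      then show ?thesis
        using assms by (auto simp: pmf_pair pmf_Pi prod.distrib prod_eq_iff)
    qed
    finally show "pmf (map_pmf ?zip (pair_pmf (Pi_pmf I d p) (Pi_pmf I d' q))) k
        = pmf (Pi_pmf I (d, d') (\<lambda>i. pair_pmf (p i) (q i))) k" .
  qed
  then have "map_pmf (\<lambda>k. (\<lambda>(a, b). h a b) \<circ> k) (map_pmf ?zip (pair_pmf (Pi_pmf I d p) (Pi_pmf I d' q)))
      = Pi_pmf I (h d d') (\<lambda>i. map_pmf (\<lambda>(a, b). h a b) (pair_pmf (p i) (q i)))"
    using assms by (simp add: Pi_pmf_map[where dflt = "(d, d')"])
  then show ?thesis
    by (simp add: pmf.map_comp o_def case_prod_unfold)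
qed

definition difference_pmf :: "nat pmf \<Rightarrow> int pmf" where
  "difference_pmf F = map_pmf (\<lambda>(a, b). int a - int b) (pair_pmf F F)"

lemma map_gosper_pmf:
  "map_pmf (\<lambda>(A, B) i. int (A i) - int (B i)) (gosper_pmf F m) = iid_pmf (difference_pmf F) m"
  using map_pair_Pi_pmf[of "{1..m}" "\<lambda>a b. int a - int b" 0 "\<lambda>_. F" 0 "\<lambda>_. F"]
  by (simp add: gosper_pmf_def iid_pmf_def difference_pmf_def)

text \<open>Writing an independent pair as a family indexed by \<open>bool\<close> makes the moment
  formula for sums of independent variables available for a difference.\<close>

lemma pair_pmf_conv_Pi_pmf:
  "pair_pmf p p = map_pmf (\<lambda>x. (x True, x False)) (Pi_pmf UNIV d (\<lambda>_. p))"
proof -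
  have "Pi_pmf {True, False} d (\<lambda>_. p)
      = map_pmf (\<lambda>(y, f). f(True := y)) (pair_pmf p (Pi_pmf {False} d (\<lambda>_. p)))"
    by (rule Pi_pmf_insert) auto
  moreover have "{True, False} = UNIV" by auto
  ultimately have eq: "Pi_pmf UNIV d (\<lambda>_. p)
      = map_pmf (\<lambda>(y, f). f(True := y)) (pair_pmf p (Pi_pmf {False} d (\<lambda>_. p)))"
    by (simp only:)
  show ?thesis
    unfolding eq Pi_pmf_singleton pair_map_pmf2 pmf.map_comp
    by (simp add: o_def case_prod_unfold)
qed

text \<open>Write \<open>a - b\<close> as \<open>(a - lam) + (lam - b)\<close>, a sum of two
  independent centred variables with the same second moment.\<close>

lemma difference_pmf_moments:
  fixes F :: "nat pmf"
  assumes int: "integrable (measure_pmf F) real"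
    and mean: "measure_pmf.expectation F real = lam"
    and sq: "integrable (measure_pmf F) (\<lambda>x. (real x - lam)\<^sup>2)"
  shows "integrable (measure_pmf (difference_pmf F)) real_of_int" (is ?goal1)
    and "measure_pmf.expectation (difference_pmf F) real_of_int = 0" (is ?goal2)
    and "integrable (measure_pmf (difference_pmf F)) (\<lambda>k. (real_of_int k)\<^sup>2)" (is ?goal3)
    and "measure_pmf.expectation (difference_pmf F) (\<lambda>k. (real_of_int k)\<^sup>2)
       = 2 * measure_pmf.expectation F (\<lambda>x. (real x - lam)\<^sup>2)" (is ?goal4)
proof -
  define Q where "Q = Pi_pmf (UNIV :: bool set) 0 (\<lambda>_. F)"
  define X where "X i x = (if i then real (x i) - lam else lam - real (x i))" for i and x :: "bool \<Rightarrow> nat"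
  have D: "difference_pmf F = map_pmf (\<lambda>x. int (x True) - int (x False)) Q"
    by (simp add: difference_pmf_def Q_def pair_pmf_conv_Pi_pmf[of F 0] pmf.map_comp o_def)
  have X: "real_of_int (int (x True) - int (x False)) = (\<Sum>i\<in>UNIV. X i x)" for x
    by (simp add: X_def UNIV_bool)
  have ind: "prob_space.indep_vars (measure_pmf Q) (\<lambda>_. borel) X UNIV"
    unfolding X_def Q_def
    by (rule prob_space.indep_vars_compose2[OF measure_pmf.prob_space_axioms indep_vars_Pi_pmf, where Y = "\<lambda>i k. if i then real k - lam else lam - real k"]) auto
  have proj: "map_pmf (\<lambda>x. x i) Q = F" for i
    by (simp add: Q_def Pi_pmf_component)
  have exp: "measure_pmf.expectation Q (\<lambda>x. f (x i)) = measure_pmf.expectation F f"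
    and int': "integrable (measure_pmf Q) (\<lambda>x. f (x i)) = integrable (measure_pmf F) f" for f :: "nat \<Rightarrow> real" and i
    by (simp_all flip: proj[of i])
  have X_int: "integrable (measure_pmf Q) (X i)" for i
    using int int'[of real i] by (cases i) (simp_all add: X_def[abs_def])
  have X_mean: "measure_pmf.expectation Q (X i) = 0" for i
    using int mean int'[of real i] exp[of real i] by (cases i) (simp_all add: X_def[abs_def])
  have X_sq: "(X i x)\<^sup>2 = (real (x i) - lam)\<^sup>2" for i x
    by (simp add: X_def power2_commute)
  have X_int2: "integrable (measure_pmf Q) (\<lambda>x. (X i x)\<^sup>2)" for i
    using sq int'[of "\<lambda>k. (real k - lam)\<^sup>2" i] by (simp add: X_sq)
  have X_sq_exp: "measure_pmf.expectation Q (\<lambda>x. (X i x)\<^sup>2)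
      = measure_pmf.expectation F (\<lambda>k. (real k - lam)\<^sup>2)" for i
    using exp[of "\<lambda>k. (real k - lam)\<^sup>2" i] by (simp add: X_sq)
  note sm = prob_space.second_moment_sum_indep[OF measure_pmf.prob_space_axioms finite ind X_int2 X_mean]
  show ?goal1 ?goal2 ?goal3 ?goal4
    unfolding D integrable_map_pmf_eq integral_map_pmf X
    using X_int X_mean sm by (simp_all add: X_sq_exp)
qed

text \<open>\<beta> depends on the sequences only through their differences, whose law is
  \<open>iid_pmf p m\<close>. By linearity only expected minima remain, and the block after time
  \<open>r\<close> has the law of a walk of \<open>m - r\<close> steps.\<close>

lemma expectation_gosper_beta:
  fixes F :: "nat pmf"
  defines "p \<equiv> difference_pmf F"
  assumes int: "integrable (measure_pmf p) real_of_int"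
    and mean: "measure_pmf.expectation p real_of_int = 0"
  defines "e \<equiv> \<lambda>n. - measure_pmf.expectation (iid_pmf p n) (\<lambda>x. real_of_int (run_min x n))"
  shows "measure_pmf.expectation (gosper_pmf F m) (\<lambda>\<omega>. real (gosper_beta m \<omega>))
       = (\<Sum>r\<le>m. e r + e (m - r) - e m)"
proof -
  let ?E = "\<lambda>f. measure_pmf.expectation (iid_pmf p m) (\<lambda>x. real_of_int (f x))"
  let ?shift = "\<lambda>r x. run_min (\<lambda>i. x (i + r)) (m - r)"
  have beta: "real (gosper_beta m \<omega>) = (\<lambda>x. \<Sum>r\<le>m. real_of_int (run_min x m)
      - real_of_int (run_min x r) - real_of_int (?shift r x)) ((\<lambda>(A, B) i. int (A i) - int (B i)) \<omega>)" for \<omega>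
  proof -
    obtain A B where \<omega>: "\<omega> = (A, B)" by force
    have "int (gosper_beta m (A, B)) = (\<Sum>r\<le>m. run_min (\<lambda>i. int (A i) - int (B i)) m
        - run_min (\<lambda>i. int (A i) - int (B i)) r - ?shift r (\<lambda>i. int (A i) - int (B i)))"
      unfolding gosper_beta_eq_sum by (intro sum.cong refl valley_conv_run_min) simp
    then have "real_of_int (int (gosper_beta m (A, B))) = real_of_int (\<Sum>r\<le>m. run_min (\<lambda>i. int (A i) - int (B i)) m
        - run_min (\<lambda>i. int (A i) - int (B i)) r - ?shift r (\<lambda>i. int (A i) - int (B i)))"
      by (simp only:)
    then show ?thesis by (simp add: \<omega>)
  qed
  have integrable: "integrable (measure_pmf (iid_pmf p m)) (\<lambda>x. real_of_int (run_min x r))"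
    "integrable (measure_pmf (iid_pmf p m)) (\<lambda>x. real_of_int (?shift r x))" if "r \<le> m" for r
    using that
    by (auto intro!: integrable_iid_pmf[OF int mean] abs_run_min_le abs_run_min_shift_le simp del: One_nat_def)
  have "measure_pmf.expectation (gosper_pmf F m) (\<lambda>\<omega>. real (gosper_beta m \<omega>))
      = measure_pmf.expectation (iid_pmf p m) (\<lambda>x. \<Sum>r\<le>m. real_of_int (run_min x m)
          - real_of_int (run_min x r) - real_of_int (?shift r x))"
    unfolding beta p_def map_gosper_pmf[symmetric] integral_map_pmf ..
  also have "\<dots> = (\<Sum>r\<le>m. ?E (\<lambda>x. run_min x m) - ?E (\<lambda>x. run_min x r) - ?E (?shift r))"
    using integrable by (subst Bochner_Integration.integral_sum) auto
  also have "\<dots> = (\<Sum>r\<le>m. e r + e (m - r) - e m)"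
  proof (rule sum.cong[OF refl])
    fix r assume "r \<in> {..m}"
    then show "?E (\<lambda>x. run_min x m) - ?E (\<lambda>x. run_min x r) - ?E (?shift r) = e r + e (m - r) - e m"
      using expectation_run_min_shift[OF int mean, of 0 r m]
        expectation_run_min_shift[OF int mean, of r "m - r" m]
      by (simp add: e_def)
  qed
  finally show ?thesis .
qed

theorem theorem3:
  fixes F :: "nat pmf" and lam V :: real
  assumes "integrable (measure_pmf F) real"
    and "measure_pmf.expectation F real = lam"
    and "integrable (measure_pmf F) (\<lambda>x. (real x - lam)\<^sup>2)"
    and "measure_pmf.variance F real = V"
    and "Gcd (set_pmf F) = 1"
  shows "(\<lambda>m. measure_pmf.expectation (gosper_pmf F m) (\<lambda>\<omega>. real (gosper_beta m \<omega>)))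
           \<sim>[at_top] (\<lambda>m. 2 / 3 * sqrt (V / pi) * real m powr (3 / 2))"
proof -
  define p where "p = difference_pmf F"
  define e where "e n = - measure_pmf.expectation (iid_pmf p n) (\<lambda>x. real_of_int (run_min x n))" for n
  have V: "measure_pmf.expectation F (\<lambda>x. (real x - lam)\<^sup>2) = V"
    using assms(2,4) by simp
  note moments = difference_pmf_moments[OF assms(1-3), folded p_def, unfolded V]
  have beta: "measure_pmf.expectation (gosper_pmf F m) (\<lambda>\<omega>. real (gosper_beta m \<omega>))
      = (\<Sum>r\<le>m. e r + e (m - r) - e m)" for m
    unfolding e_def p_def
    by (rule expectation_gosper_beta) (use moments(1,2) in \<open>simp_all only: p_def\<close>)
  have "V \<ge> 0"
    unfolding V[symmetric] by (rule Bochner_Integration.integral_nonneg) simp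
  show ?thesis
  \<comment> \<open>For \<open>V = 0\<close> the steps vanish almost surely and both sides are
    identically zero; dividing by the leading constant requires \<open>V > 0\<close>.\<close>
  proof (cases "V = 0")
    case True
    then have "AE k in measure_pmf p. (real_of_int k)\<^sup>2 = 0"
      using integral_nonneg_eq_0_iff_AE[OF moments(3)] moments(4) by simp
    then have "set_pmf p \<subseteq> {0}"
      by (auto simp: AE_measure_pmf_iff)
    then have "p = return_pmf 0"
      by (simp add: set_pmf_subset_singleton)
    moreover have "run_min (\<lambda>_. 0) n = 0" for n
      using run_min_mem[of n "\<lambda>_. 0"] by (auto simp: walk_def)
    ultimately have "e n = 0" for n
      by (simp add: e_def iid_pmf_def Pi_pmf_return_pmf)
    then show ?thesis
      using True by (simp add: beta)
  next
    case False
    then have "V > 0" using \<open>V \<ge> 0\<close> by simp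
    define a where "a n = measure_pmf.expectation (iid_pmf p n) (\<lambda>x. real_of_int \<bar>walk x n\<bar>)" for n
    \<comment> \<open>A step is a difference of two independent copies, so its variance is
      \<open>2 * V\<close> and \<open>\<sigma> = sqrt (2 * V)\<close>.\<close>
    have "(\<lambda>n. a n / sqrt (real n)) \<longlonglongrightarrow> sqrt (2 * V) * sqrt (2 / pi)"
      unfolding a_def using moments \<open>V > 0\<close> by (intro abs_walk_asymp) simp_all
    moreover have "e (Suc n) = e n + a (Suc n) / (2 * real (Suc n))" for n
      using spitzer_run_min[OF moments(1,2), of n] by (simp add: e_def a_def)
    ultimately have "(\<lambda>n. e n / sqrt (real n)) \<longlonglongrightarrow> sqrt (2 * V) * sqrt (2 / pi)"
      by (rule sqrt_asymp_of_increments[rotated])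
    also have "sqrt (2 * V) * sqrt (2 / pi) = 2 * sqrt (V / pi)"
      by (simp add: real_sqrt_mult real_sqrt_divide)
    finally have lim: "(\<lambda>m. (\<Sum>r\<le>m. e r + e (m - r) - e m) / real m powr (3 / 2))
        \<longlonglongrightarrow> 2 * sqrt (V / pi) / 3"
      by (rule sum_excess_asymp)
    show ?thesis
    proof (rule asymp_equivI')
      have "(\<lambda>m. (\<Sum>r\<le>m. e r + e (m - r) - e m) / real m powr (3 / 2) / (2 / 3 * sqrt (V / pi)))
          \<longlonglongrightarrow> 2 * sqrt (V / pi) / 3 / (2 / 3 * sqrt (V / pi))"
        using \<open>V > 0\<close> by (intro tendsto_divide lim tendsto_const) simp
      then show "(\<lambda>m. measure_pmf.expectation (gosper_pmf F m) (\<lambda>\<omega>. real (gosper_beta m \<omega>))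
          / (2 / 3 * sqrt (V / pi) * real m powr (3 / 2))) \<longlonglongrightarrow> 1"
        using \<open>V > 0\<close> by (simp add: beta mult.commute)
    qed
  qed
qed

end
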